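(* For every $n\geq2$ and every unit vector $\omega\in\mathbb R^n$ (i.e. $\|\omega\|_2=1$), $$K_n(\omega)\geq\frac1{\sqrt2}+\frac1{36}\,\tau(\omega).$$
   Context: For $\omega\in\mathbb R^n$, $K_n(\omega)=\mathbb E\left|\sum_{i=1}^n\omega_i\epsilon_i\right|$, where $\epsilon_1,\dots,\epsilon_n$ are independent Rademacher random variables (uniform on $\{-1,1\}$). For a unit vector $\omega\in\mathbb R^n$, $$\tau(\omega)=\min_{1\le i<j\le n}\left\|\omega\pm\tfrac1{\sqrt2}e_i\pm\tfrac1{\sqrt2}e_j\right\|_2,$$ where the minimum is also taken over all four choices of the two signs and $e_i$ is the $i$-th standard basis vector of $\mathbb R^n$. *)

theory Defs
  imports "HOL-Analysis.Analysis" "HOL-Probability.Probability"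
begin

definition rademacher_pmf :: "real pmf" where
  "rademacher_pmf = pmf_of_set {-1, 1}"

(* The law of independent Rademacher variables indexed by the coordinates: the product
   of the marginal laws.  The default value 0 of the product is irrelevant, since the
   index set is the whole type. *)
definition khinchine_K :: "real ^ 'n \<Rightarrow> real" where
  "khinchine_K \<omega> =
     measure_pmf.expectation (Pi_pmf (UNIV :: 'n set) 0 (\<lambda>_. rademacher_pmf))
       (\<lambda>\<epsilon>. \<bar>\<Sum>i\<in>UNIV. \<omega> $ i * \<epsilon> i\<bar>)"

(* The index type carries no order, so i < j becomes i \<noteq> j; as both signs vary
   independently, exchanging i and j yields the same family of vectors.  The set is
   nonempty as soon as CARD('n) is at least 2. *)
definition tau :: "real ^ 'n \<Rightarrow> real" where
  "tau \<omega> =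
     Min {norm (\<omega> + (s / sqrt 2) *\<^sub>R axis i 1 + (t / sqrt 2) *\<^sub>R axis j 1) | i j s t.
            i \<noteq> j \<and> s \<in> {-1, 1} \<and> t \<in> {-1, 1}}"

end

theory Submission
  imports Defs
begin

text \<open>
  Write \<open>S = \<Sum> w\<^sub>k \<epsilon>\<^sub>k\<close> and \<open>K = E \<bar>S\<bar>\<close>, let \<open>a \<ge> b\<close> be the two largest absolute values of the
  coordinates of the unit vector \<open>w\<close>, and put \<open>T\<^sup>2 = 2 - sqrt 2 * (a + b)\<close>.  Choosing the signs
  in the definition of \<open>\<tau>\<close> opposite to those of the coordinates gives \<open>\<tau> \<le> T\<close>
  (\<open>tau_le_pair\<close>), so it is enough to show \<open>K \<ge> 1 / sqrt 2 + T / 36\<close>.  Two methods for Szarek's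
  inequality \<open>K \<ge> 1 / sqrt 2\<close> leave a surplus, in complementary regions of \<open>(a, b)\<close>.

  Near the extremiser \<open>a = b = 1 / sqrt 2\<close> the surplus has to be linear in the distance.  This
  comes from the spectral argument of Latala and Oleszkiewicz.  The function \<open>\<bar>S\<bar>\<close> is even on the
  cube, so it satisfies a Poincare inequality with the constant 2 instead of 1
  (\<open>poincare_signs_even\<close>).  With \<open>R\<^sub>k = S - w\<^sub>k \<epsilon>\<^sub>k\<close>, the product of the values of \<open>\<bar>S\<bar>\<close> at the two
  ends of an edge in direction \<open>k\<close> is \<open>\<bar>R\<^sub>k\<^sup>2 - w\<^sub>k\<^sup>2\<bar>\<close>, and expanding the Dirichlet form yields
  \<open>2 * K\<^sup>2 \<ge> 1 + \<Sum> E (max 0 (w\<^sub>k\<^sup>2 - R\<^sub>k\<^sup>2))\<close>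
  (\<open>khinchine_deficit\<close>).  The two terms that belong to \<open>a\<close> and \<open>b\<close> are bounded below by Szarek's
  inequality for the remaining coordinates (\<open>khinchine_two_coefficients\<close>).

  Away from the extremiser this surplus may vanish, for instance at
  \<open>(1/2, 1/2, 1/2, 1/2)\<close>.  There Haagerup's integral method works.  From
  \<open>\<bar>s\<bar> = (2 / \<pi>) \<integral>\<^sub>0\<^sup>\<infinity> (1 - cos (s t)) / t\<^sup>2 dt\<close>, the product formula for \<open>E cos (t S)\<close> and the weighted
  inequality between the arithmetic and geometric means one gets, for all weights \<open>p\<^sub>k\<close> with sum 1,
  \<open>K \<ge> \<Sum> \<bar>w\<^sub>k\<bar> * (2 / \<pi>) * W (1 / p\<^sub>k)\<close>, where \<open>W s\<close> is the integral of \<open>cos\<^sup>s\<close> over \<open>(0, \<pi>/2)\<close>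
  (\<open>haagerup_lower_bound\<close>).  The function \<open>sqrt s * W s\<close> is increasing
  (\<open>sqrt_wallis_mono\<close>), so only its values at the integers 2, 3, 4 and 8 enter.  The weights are
  \<open>p\<^sub>k = w\<^sub>k\<^sup>2\<close> as long as \<open>a \<le> 1 / sqrt 2\<close>; for \<open>a\<close> slightly larger, the largest
  coordinate receives the weight \<open>1/2\<close>.  Finally \<open>K \<ge> a\<close> settles large \<open>a\<close>.
\<close>


section \<open>Averages over sign vectors\<close>

text \<open>
  The value 0 off the index set makes this set the support of the product law in the
  definition of \<open>khinchine_K\<close>, and it is stable under \<open>x \<mapsto> - x\<close>.
\<close>
definition signs :: "'i set \<Rightarrow> ('i \<Rightarrow> real) set" where
  "signs A = PiE_dflt A 0 (\<lambda>_. {-1, 1})"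

definition Esigns :: "'i set \<Rightarrow> (('i \<Rightarrow> real) \<Rightarrow> real) \<Rightarrow> real" where
  "Esigns A F = (\<Sum>x\<in>signs A. F x) / 2 ^ card A"

lemma signs_empty: "signs {} = {\<lambda>_. 0}"
  by (auto simp: signs_def PiE_dflt_def)

lemma finite_signs: "finite A \<Longrightarrow> finite (signs A)"
  unfolding signs_def by (intro finite_PiE_dflt) auto

lemma card_signs: "finite A \<Longrightarrow> card (signs A) = 2 ^ card A"
  unfolding signs_def by (subst card_PiE_dflt) (auto simp: card_insert_if numeral_2_eq_2)

lemma signs_insert:
  assumes "i \<notin> A"
  shows "signs (insert i A) = (\<lambda>x. x(i := 1)) ` signs A \<union> (\<lambda>x. x(i := -1)) ` signs A"
    (is "?L = ?R")
proof (rule Set.set_eqI)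
  fix y
  show "y \<in> ?L \<longleftrightarrow> y \<in> ?R"
  proof
    assume y: "y \<in> ?L"
    have 1: "y(i := 0) \<in> signs A"
      using y assms by (auto simp: signs_def PiE_dflt_def)
    have "y i = 1 \<or> y i = -1"
      using y by (auto simp: signs_def PiE_dflt_def)
    then have "y = (y(i := 0))(i := 1) \<or> y = (y(i := 0))(i := -1)"
      by (metis fun_upd_triv fun_upd_upd)
    then show "y \<in> ?R" using 1 by blast
  next
    assume "y \<in> ?R"
    then show "y \<in> ?L"
      by (force simp: signs_def PiE_dflt_def)
  qed
qed

lemma Esigns_empty [simp]: "Esigns {} F = F (\<lambda>_. 0)"
  by (simp add: Esigns_def signs_empty)

lemma signs_off: "x \<in> signs A \<Longrightarrow> i \<notin> A \<Longrightarrow> x i = 0"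
  by (auto simp: signs_def PiE_dflt_def)

lemma signs_on: "x \<in> signs A \<Longrightarrow> i \<in> A \<Longrightarrow> x i = 1 \<or> x i = -1"
  by (auto simp: signs_def PiE_dflt_def)

lemma inj_on_signs_upd: "i \<notin> A \<Longrightarrow> inj_on (\<lambda>x. x(i := c)) (signs A)"
  unfolding inj_on_def
  by (metis fun_upd_triv fun_upd_upd signs_off)

lemma Esigns_insert:
  assumes "finite A" "i \<notin> A"
  shows "Esigns (insert i A) F =
    (Esigns A (\<lambda>x. F (x(i := 1))) + Esigns A (\<lambda>x. F (x(i := -1)))) / 2"
proof -
  have disj: "(\<lambda>x. x(i := 1)) ` signs A \<inter> (\<lambda>x. x(i := -1::real)) ` signs A = {}"
  proof -
    { fix x y :: "'a \<Rightarrow> real" assume "x(i := 1) = y(i := -1)"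
      from fun_cong[OF this, of i] have False by simp }
    then show ?thesis by blast
  qed
  have "(\<Sum>x\<in>signs (insert i A). F x) =
      (\<Sum>x\<in>signs A. F (x(i := 1))) + (\<Sum>x\<in>signs A. F (x(i := -1)))"
    unfolding signs_insert[OF assms(2)]
    using assms disj by (simp add: sum.union_disjoint finite_signs sum.reindex inj_on_signs_upd)
  then show ?thesis
    using assms by (simp add: Esigns_def field_simps)
qed

lemma Esigns_add: "Esigns A (\<lambda>x. F x + G x) = Esigns A F + Esigns A G"
  by (simp add: Esigns_def sum.distrib add_divide_distrib)

lemma Esigns_diff: "Esigns A (\<lambda>x. F x - G x) = Esigns A F - Esigns A G"
  by (simp add: Esigns_def sum_subtractf diff_divide_distrib)

lemma Esigns_cmult: "Esigns A (\<lambda>x. c * F x) = c * Esigns A F"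
  by (simp add: Esigns_def sum_distrib_left[symmetric])

lemma Esigns_divide: "Esigns A (\<lambda>x. F x / c) = Esigns A F / c"
  by (simp add: Esigns_def sum_divide_distrib[symmetric])

lemma Esigns_const: "finite A \<Longrightarrow> Esigns A (\<lambda>_. c) = c"
  by (simp add: Esigns_def card_signs)

lemma Esigns_mono: "(\<And>x. x \<in> signs A \<Longrightarrow> F x \<le> G x) \<Longrightarrow> Esigns A F \<le> Esigns A G"
  by (simp add: Esigns_def divide_right_mono sum_mono)

lemma Esigns_cong: "(\<And>x. x \<in> signs A \<Longrightarrow> F x = G x) \<Longrightarrow> Esigns A F = Esigns A G"
  by (simp add: Esigns_def)

lemma Esigns_nonneg: "(\<And>x. x \<in> signs A \<Longrightarrow> 0 \<le> F x) \<Longrightarrow> 0 \<le> Esigns A F"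
  by (simp add: Esigns_def sum_nonneg)

lemma Esigns_neg:
  assumes "finite A"
  shows "Esigns A (\<lambda>x. F (\<lambda>j. - x j)) = Esigns A F"
  using assms
proof (induction A arbitrary: F)
  case (insert i A)
  have upd: "(\<lambda>j. - (x(i := c)) j) = (\<lambda>j. - x j)(i := - c)" for x :: "'a \<Rightarrow> real" and c
    by (auto simp: fun_eq_iff)
  show ?case
    using insert.IH[of "\<lambda>x. F (x(i := 1))"] insert.IH[of "\<lambda>x. F (x(i := -1))"] insert.hyps
    by (simp add: Esigns_insert upd del: fun_upd_apply)
qed simp

text \<open>
  The quadratic form of the generator of the random walk on the cube; the character of a set of
  \<open>k\<close> indices is an eigenfunction with eigenvalue \<open>k\<close>.
\<close>

section \<open>A spectral gap for even functions on the cube\<close>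

definition dirichlet :: "'i set \<Rightarrow> (('i \<Rightarrow> real) \<Rightarrow> real) \<Rightarrow> real" where
  "dirichlet A f = (\<Sum>i\<in>A. Esigns A (\<lambda>x. (f x - f (x(i := - x i)))\<^sup>2)) / 4"

lemma dirichlet_nonneg: "0 \<le> dirichlet A f"
  by (simp add: dirichlet_def sum_nonneg Esigns_nonneg)

text \<open>
  Splitting off one coordinate turns \<open>f\<close> into its half sum \<open>e f\<close> and its half difference \<open>d f\<close>
  along that coordinate.  By the parallelogram identity the form splits without cross terms; this
  drives the inductive proofs of the two Poincare inequalities.
\<close>
lemma dirichlet_insert:
  assumes "finite A" "i \<notin> A"
  defines "e \<equiv> \<lambda>f x. (f (x(i := 1)) + f (x(i := -1))) / 2"
      and "d \<equiv> \<lambda>f x. (f (x(i := 1)) - f (x(i := -1))) / (2::real)"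
  shows "dirichlet (insert i A) f =
    dirichlet A (e f) + dirichlet A (d f) + Esigns A (\<lambda>x. (d f x)\<^sup>2)"
proof -
  let ?u = "\<lambda>x. f (x(i := 1))" and ?v = "\<lambda>x. f (x(i := -1))"
  have flip: "Esigns (insert i A) (\<lambda>x. (f x - f (x(j := - x j)))\<^sup>2) =
      Esigns A (\<lambda>x. (e f x - e f (x(j := - x j)))\<^sup>2) +
      Esigns A (\<lambda>x. (d f x - d f (x(j := - x j)))\<^sup>2)" if "j \<in> A" for j
  proof -
    have ne: "j \<noteq> i" using that assms by auto
    have tw: "(x(i := c))(j := y) = (x(j := y))(i := c)" for x :: "'a \<Rightarrow> real" and c y
      using ne by (rule fun_upd_twist[OF not_sym])
    have pw: "((p - r)\<^sup>2 + (q - s)\<^sup>2) / 2 =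
        ((p + q) / 2 - (r + s) / 2)\<^sup>2 + ((p - q) / 2 - (r - s) / 2)\<^sup>2" for p q r s :: real
      by (simp add: power2_eq_square field_simps)
    have "Esigns (insert i A) (\<lambda>x. (f x - f (x(j := - x j)))\<^sup>2) =
      Esigns A (\<lambda>x. ((?u x - ?u (x(j := - x j)))\<^sup>2 + (?v x - ?v (x(j := - x j)))\<^sup>2) / 2)"
      using assms(1,2) ne by (simp add: Esigns_insert Esigns_add Esigns_divide tw)
    also have "\<dots> = Esigns A (\<lambda>x. (e f x - e f (x(j := - x j)))\<^sup>2) +
      Esigns A (\<lambda>x. (d f x - d f (x(j := - x j)))\<^sup>2)"
      unfolding pw e_def d_def Esigns_add ..
    finally show ?thesis .
  qed
  have own: "Esigns (insert i A) (\<lambda>x. (f x - f (x(i := - x i)))\<^sup>2) = 4 * Esigns A (\<lambda>x. (d f x)\<^sup>2)"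
  proof -
    have 1: "(?v x - ?u x)\<^sup>2 = (?u x - ?v x)\<^sup>2" for x
      by (rule power2_commute)
    show ?thesis
      using assms(1,2) by (simp add: Esigns_insert d_def power_divide Esigns_divide 1)
  qed
  show ?thesis
    using assms(1,2)
    by (simp add: dirichlet_def own flip sum.distrib add_divide_distrib)
qed

lemma Esigns_square_insert:
  assumes "finite A" "i \<notin> A"
  shows "Esigns (insert i A) (\<lambda>x. (f x)\<^sup>2) =
    Esigns A (\<lambda>x. ((f (x(i := 1)) + f (x(i := -1))) / 2)\<^sup>2) +
    Esigns A (\<lambda>x. ((f (x(i := 1)) - f (x(i := -1))) / 2)\<^sup>2)"
proof -
  have pw: "((p + q) / 2)\<^sup>2 + ((p - q) / 2)\<^sup>2 = (p\<^sup>2 + q\<^sup>2) / 2" for p q :: real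
    by (simp add: power2_eq_square field_simps)
  show ?thesis
    using assms by (simp add: Esigns_insert Esigns_add[symmetric] pw Esigns_divide)
qed

lemma poincare_signs:
  assumes "finite A"
  shows "Esigns A (\<lambda>x. (f x)\<^sup>2) - (Esigns A f)\<^sup>2 \<le> dirichlet A f"
  using assms
proof (induction A arbitrary: f)
  case (insert i A)
  let ?e = "\<lambda>x. (f (x(i := 1)) + f (x(i := -1))) / 2"
  let ?d = "\<lambda>x. (f (x(i := 1)) - f (x(i := -1))) / 2"
  have "Esigns (insert i A) f = Esigns A ?e"
    using insert.hyps by (simp add: Esigns_insert Esigns_add Esigns_divide)
  then show ?case
    using insert.IH[of ?e] insert.hyps dirichlet_nonneg[of A ?d]
    by (simp add: Esigns_square_insert dirichlet_insert)
qed (simp add: dirichlet_def)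

text \<open>
  Even functions have no component on the characters of single indices, so their spectral gap
  is 2.  In the induction the half sum is even again, while the half difference is odd: it has mean
  zero, so the ordinary Poincare inequality contributes its second moment once, and the
  edge that was split off contributes it a second time.
\<close>
lemma poincare_signs_even:
  assumes "finite A" "\<And>x. f (\<lambda>j. - x j) = f x"
  shows "2 * (Esigns A (\<lambda>x. (f x)\<^sup>2) - (Esigns A f)\<^sup>2) \<le> dirichlet A f"
  using assms
proof (induction A arbitrary: f)
  case (insert i A)
  let ?e = "\<lambda>x. (f (x(i := 1)) + f (x(i := -1))) / 2"
  let ?d = "\<lambda>x. (f (x(i := 1)) - f (x(i := -1))) / 2"
  have upd: "f ((\<lambda>j. - x j)(i := c)) = f (x(i := - c))" for x c
  proof -
    have "(\<lambda>j. - x j)(i := c) = (\<lambda>j. - (x(i := - c)) j)" by (auto simp: fun_eq_iff)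
    then show ?thesis using insert.prems[of "x(i := - c)"] by (simp only:)
  qed
  have e: "?e (\<lambda>j. - x j) = ?e x" for x by (simp add: upd)
  have d: "?d (\<lambda>j. - x j) = - ?d x" for x by (simp add: upd field_simps)
  have "Esigns A ?d = Esigns A (\<lambda>x. - 1 * ?d x)"
    using Esigns_neg[OF insert.hyps(1), of ?d] unfolding d by (simp only: mult_minus1)
  then have "Esigns A ?d = - 1 * Esigns A ?d"
    by (simp only: Esigns_cmult)
  \<comment> \<open>The half difference is odd, so its mean is its own negative.\<close>
  then have d0: "Esigns A ?d = 0" by simp
  have "Esigns (insert i A) f = Esigns A ?e"
    using insert.hyps by (simp add: Esigns_insert Esigns_add Esigns_divide)
  then show ?case
    using insert.IH[of ?e] poincare_signs[OF insert.hyps(1), of ?d] insert.hyps d0 e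
    by (simp add: Esigns_square_insert dirichlet_insert)
qed (simp add: dirichlet_def)

section \<open>The Khinchine deficit\<close>

lemma Esigns_linear_square:
  assumes "finite A"
  shows "Esigns A (\<lambda>x. (\<Sum>i\<in>A. a i * x i)\<^sup>2) = (\<Sum>i\<in>A. (a i)\<^sup>2)"
proof -
  have "Esigns A (\<lambda>x. (c + (\<Sum>i\<in>A. a i * x i))\<^sup>2) = c\<^sup>2 + (\<Sum>i\<in>A. (a i)\<^sup>2)" for c
    using assms
  proof (induction A arbitrary: c)
    case (insert i A)
    let ?S = "\<lambda>x. \<Sum>j\<in>A. a j * x j"
    have s: "(\<Sum>j\<in>A. a j * (x(i := r)) j) = ?S x" for x r
      using insert.hyps by (intro sum.cong) auto
    have pm: "(c + (a i + t))\<^sup>2 = (c + a i + t)\<^sup>2" "(c + (- a i + t))\<^sup>2 = (c - a i + t)\<^sup>2" for t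
      by (simp_all add: algebra_simps)
    have "Esigns (insert i A) (\<lambda>x. (c + (\<Sum>j\<in>insert i A. a j * x j))\<^sup>2) =
       (Esigns A (\<lambda>x. (c + a i + ?S x)\<^sup>2) + Esigns A (\<lambda>x. (c - a i + ?S x)\<^sup>2)) / 2"
      using insert.hyps by (simp add: Esigns_insert s pm del: fun_upd_apply)
        (simp add: algebra_simps)
    also have "\<dots> = ((c + a i)\<^sup>2 + (\<Sum>i\<in>A. (a i)\<^sup>2) + ((c - a i)\<^sup>2 + (\<Sum>i\<in>A. (a i)\<^sup>2))) / 2"
      by (simp only: insert.IH)
    finally show ?case
      using insert.hyps by (simp add: power2_eq_square algebra_simps)
  qed simp
  from this[of 0] show ?thesis by simp
qed

lemma Esigns_flip:
  assumes "finite A" "i \<in> A"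
  shows "Esigns A (\<lambda>x. F (x(i := - x i))) = Esigns A F"
proof -
  have "Esigns (insert i (A - {i})) (\<lambda>x. F (x(i := - x i))) = Esigns (insert i (A - {i})) F"
    using assms(1) by (simp add: Esigns_insert del: insert_Diff_single)
  then show ?thesis using assms(2) by (simp add: insert_absorb)
qed

text \<open>
  The terms \<open>max 0 ((a i)\<^sup>2 - (R i x)\<^sup>2)\<close> record how much the triangle inequality loses in the
  argument of Latala and Oleszkiewicz.  They appear because
  \<open>\<bar>u\<bar> = u + 2 * max 0 (- u)\<close> for \<open>u = (R i x)\<^sup>2 - (a i)\<^sup>2\<close>, which is up to sign the product of the
  two values of the linear form at the ends of an edge in direction \<open>i\<close>.
\<close>
lemma khinchine_deficit:
  fixes a :: "'i \<Rightarrow> real"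
  assumes A: "finite A"
  defines "R \<equiv> \<lambda>i x. \<Sum>j\<in>A - {i}. a j * x j"
  shows "(\<Sum>i\<in>A. (a i)\<^sup>2) + (\<Sum>i\<in>A. Esigns A (\<lambda>x. max 0 ((a i)\<^sup>2 - (R i x)\<^sup>2)))
    \<le> 2 * (Esigns A (\<lambda>x. \<bar>\<Sum>i\<in>A. a i * x i\<bar>))\<^sup>2"
proof -
  define f where "f = (\<lambda>x. \<bar>\<Sum>i\<in>A. a i * x i\<bar>)"
  define Q where "Q = (\<Sum>i\<in>A. (a i)\<^sup>2)"
  define D where "D = (\<lambda>i. Esigns A (\<lambda>x. max 0 ((a i)\<^sup>2 - (R i x)\<^sup>2)))"
  have f2: "Esigns A (\<lambda>x. (f x)\<^sup>2) = Q"
    using Esigns_linear_square[OF A] by (simp add: f_def Q_def)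
  have R2: "Esigns A (\<lambda>x. (R i x)\<^sup>2) = Q - (a i)\<^sup>2" if "i \<in> A" for i
  proof -
    have "Esigns (insert i (A - {i})) (\<lambda>x. (R i x)\<^sup>2) = Esigns (A - {i}) (\<lambda>x. (R i x)\<^sup>2)"
      using A by (simp add: Esigns_insert R_def del: insert_Diff_single)
    also have "\<dots> = (\<Sum>j\<in>A - {i}. (a j)\<^sup>2)"
      unfolding R_def using A by (intro Esigns_linear_square) auto
    finally show ?thesis
      using A that by (simp add: insert_absorb Q_def sum_diff1)
  qed
  have pt: "(f x - f (x(i := - x i)))\<^sup>2 = (f x)\<^sup>2 + (f (x(i := - x i)))\<^sup>2
      - 2 * ((R i x)\<^sup>2 - (a i)\<^sup>2 + 2 * max 0 ((a i)\<^sup>2 - (R i x)\<^sup>2))"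
    if i: "i \<in> A" and x: "x \<in> signs A" for i x
  proof -
    have s: "(\<Sum>j\<in>A. a j * y j) = a i * y i + R i y" for y
      unfolding R_def using A i by (rule sum.remove)
    have R: "R i (x(i := - x i)) = R i x"
      unfolding R_def by (intro sum.cong) auto
    have "(a i * x i)\<^sup>2 = (a i)\<^sup>2"
      using signs_on[OF x i] by auto
    then have "(a i * x i + R i x) * (- (a i * x i) + R i x) = (R i x)\<^sup>2 - (a i)\<^sup>2"
      by (simp add: power2_eq_square algebra_simps)
    then have "f x * f (x(i := - x i)) = \<bar>(R i x)\<^sup>2 - (a i)\<^sup>2\<bar>"
      by (simp add: f_def s R abs_mult[symmetric])
    also have "\<dots> = (R i x)\<^sup>2 - (a i)\<^sup>2 + 2 * max 0 ((a i)\<^sup>2 - (R i x)\<^sup>2)"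
      by (simp add: max_def abs_if)
    finally show ?thesis by (simp add: power2_diff)
  qed
  have "Esigns A (\<lambda>x. (f x - f (x(i := - x i)))\<^sup>2) = 4 * (a i)\<^sup>2 - 4 * D i" if i: "i \<in> A" for i
  proof -
    have "Esigns A (\<lambda>x. (f x - f (x(i := - x i)))\<^sup>2) = Esigns A (\<lambda>x. (f x)\<^sup>2 + (f (x(i := - x i)))\<^sup>2
      - 2 * ((R i x)\<^sup>2 - (a i)\<^sup>2 + 2 * max 0 ((a i)\<^sup>2 - (R i x)\<^sup>2)))"
      using pt[OF i] by (rule Esigns_cong)
    also have "\<dots> = Q + Q - 2 * (Q - (a i)\<^sup>2 - (a i)\<^sup>2 + 2 * D i)"
      unfolding Esigns_add Esigns_diff Esigns_cmult
      using Esigns_flip[OF A i, of "\<lambda>x. (f x)\<^sup>2"]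
      by (simp add: f2 R2[OF i] Esigns_const[OF A] D_def)
    finally show ?thesis by simp
  qed
  then have "dirichlet A f = Q - (\<Sum>i\<in>A. D i)"
    by (simp add: dirichlet_def Q_def sum_subtractf sum_distrib_left[symmetric])
  moreover have "2 * (Esigns A (\<lambda>x. (f x)\<^sup>2) - (Esigns A f)\<^sup>2) \<le> dirichlet A f"
    by (rule poincare_signs_even[OF A]) (simp add: f_def sum_negf)
  ultimately show ?thesis
    unfolding f2 Q_def[symmetric] D_def[symmetric] f_def[symmetric] by simp
qed

lemma khinchine_szarek:
  assumes A: "finite A"
  shows "sqrt (\<Sum>i\<in>A. (a i)\<^sup>2) / sqrt 2 \<le> Esigns A (\<lambda>x. \<bar>\<Sum>i\<in>A. a i * x i\<bar>)"
proof -
  have "0 \<le> (\<Sum>i\<in>A. Esigns A (\<lambda>x. max 0 ((a i)\<^sup>2 - (\<Sum>j\<in>A - {i}. a j * x j)\<^sup>2)))"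
    by (intro sum_nonneg Esigns_nonneg) simp
  with khinchine_deficit[OF A, of a]
  have "(\<Sum>i\<in>A. (a i)\<^sup>2) / 2 \<le> (Esigns A (\<lambda>x. \<bar>\<Sum>i\<in>A. a i * x i\<bar>))\<^sup>2"
    by simp
  then show ?thesis
    by (metis Esigns_nonneg abs_ge_zero real_sqrt_divide real_sqrt_le_iff real_sqrt_abs abs_of_nonneg)
qed

text \<open>
  Averaging over the sign of one coordinate alone already gives this, as
  \<open>\<bar>R + u\<bar> + \<bar>R - u\<bar> \<ge> 2 * \<bar>u\<bar>\<close>.
\<close>
lemma abs_coeff_le_Esigns:
  assumes A: "finite A" and i: "i \<in> A"
  shows "\<bar>a i\<bar> \<le> Esigns A (\<lambda>x. \<bar>\<Sum>i\<in>A. a i * x i\<bar>)"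
proof -
  let ?f = "\<lambda>x. \<bar>\<Sum>i\<in>A. a i * x i\<bar>"
  have s: "(\<Sum>j\<in>A. a j * y j) = a i * y i + (\<Sum>j\<in>A - {i}. a j * y j)" for y
    using A i by (rule sum.remove)
  have "Esigns A (\<lambda>x. 2 * \<bar>a i\<bar>) \<le> Esigns A (\<lambda>x. ?f x + ?f (x(i := - x i)))"
  proof (rule Esigns_mono)
    fix x assume x: "x \<in> signs A"
    have "(\<Sum>j\<in>A - {i}. a j * (x(i := - x i)) j) = (\<Sum>j\<in>A - {i}. a j * x j)"
      by (intro sum.cong) auto
    moreover have "\<bar>a i * x i\<bar> = \<bar>a i\<bar>"
      using signs_on[OF x i] by auto
    ultimately show "2 * \<bar>a i\<bar> \<le> ?f x + ?f (x(i := - x i))"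
      unfolding s by simp
  qed
  then show ?thesis
    using Esigns_flip[OF A i, of ?f] by (simp add: Esigns_add Esigns_const[OF A])
qed

text \<open>
  Let \<open>T\<close> be the part of the linear form outside \<open>i\<close> and \<open>j\<close>.  For one of the two signs of the
  coordinate \<open>j\<close> the form without the coordinate \<open>i\<close> has the absolute value
  \<open>\<bar>\<bar>T\<bar> - \<bar>a j\<bar>\<bar>\<close>.  The maximum is dropped for that sign and replaced by 0 for the other one; what remains is linear in the first
  two absolute moments of \<open>T\<close>, and Szarek's inequality bounds the first of them.
\<close>
lemma deficit_term_bound:
  fixes a :: "'i \<Rightarrow> real"
  assumes A: "finite A" and ij: "i \<in> A" "j \<in> A" "i \<noteq> j"
  defines "q \<equiv> (\<Sum>k\<in>A - {i, j}. (a k)\<^sup>2)"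
  shows "((a i)\<^sup>2 - (a j)\<^sup>2 + sqrt 2 * \<bar>a j\<bar> * sqrt q - q) / 2 \<le>
    Esigns A (\<lambda>x. max 0 ((a i)\<^sup>2 - (\<Sum>k\<in>A - {i}. a k * x k)\<^sup>2))"
proof -
  \<comment> \<open>Extending the remaining coefficients by zero keeps all averages over the same cube.\<close>
  define b where "b = (\<lambda>k. if k \<in> A - {i, j} then a k else 0)"
  define T where "T = (\<lambda>x. \<Sum>k\<in>A. b k * x k)"
  define f where "f = (\<lambda>x. max 0 ((a i)\<^sup>2 - (\<Sum>k\<in>A - {i}. a k * x k)\<^sup>2))"
  have q: "(\<Sum>k\<in>A. (b k)\<^sup>2) = q"
    unfolding q_def by (rule sum.mono_neutral_cong_right) (use A in \<open>auto simp: b_def\<close>)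
  have T: "(\<Sum>k\<in>A - {i}. a k * x k) = a j * x j + T x" for x
  proof -
    have "A - {i} - {j} = A - {i, j}" by auto
    then have "(\<Sum>k\<in>A - {i}. a k * x k) = a j * x j + (\<Sum>k\<in>A - {i, j}. a k * x k)"
      using A ij by (subst sum.remove[of _ j]) auto
    also have "(\<Sum>k\<in>A - {i, j}. a k * x k) = T x"
      unfolding T_def by (rule sum.mono_neutral_cong_left) (use A in \<open>auto simp: b_def\<close>)
    finally show ?thesis .
  qed
  have flip: "T (x(j := y)) = T x" for x y
    unfolding T_def by (intro sum.cong) (auto simp: b_def)
  have pt: "(a i)\<^sup>2 - (a j)\<^sup>2 + 2 * \<bar>a j\<bar> * \<bar>T x\<bar> - (T x)\<^sup>2 \<le> f x + f (x(j := - x j))"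
    if x: "x \<in> signs A" for x
  proof -
    have "(\<bar>T x\<bar> - \<bar>a j\<bar>)\<^sup>2 = (a j * x j + T x)\<^sup>2 \<or> (\<bar>T x\<bar> - \<bar>a j\<bar>)\<^sup>2 = (a j * (- x j) + T x)\<^sup>2"
      using signs_on[OF x ij(2)] by (auto simp: abs_if power2_eq_square algebra_simps)
    moreover have "0 \<le> f y" "(a i)\<^sup>2 - (a j * y j + T y)\<^sup>2 \<le> f y" for y
      unfolding f_def T by auto
    note this[of x] this[of "x(j := - x j)"]
    ultimately have "(a i)\<^sup>2 - (\<bar>T x\<bar> - \<bar>a j\<bar>)\<^sup>2 \<le> f x + f (x(j := - x j))"
      unfolding flip by fastforce
    then show ?thesis
      by (simp add: power2_diff algebra_simps)
  qed
  have "(a i)\<^sup>2 - (a j)\<^sup>2 + 2 * \<bar>a j\<bar> * Esigns A (\<lambda>x. \<bar>T x\<bar>) - Esigns A (\<lambda>x. (T x)\<^sup>2) =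
      Esigns A (\<lambda>x. (a i)\<^sup>2 - (a j)\<^sup>2 + 2 * \<bar>a j\<bar> * \<bar>T x\<bar> - (T x)\<^sup>2)"
    by (simp add: Esigns_diff Esigns_add Esigns_cmult Esigns_const[OF A])
  also have "\<dots> \<le> Esigns A (\<lambda>x. f x + f (x(j := - x j)))"
    using pt by (rule Esigns_mono)
  also have "\<dots> = 2 * Esigns A f"
    by (simp add: Esigns_add Esigns_flip[OF A ij(2)])
  finally have "(a i)\<^sup>2 - (a j)\<^sup>2 + 2 * \<bar>a j\<bar> * Esigns A (\<lambda>x. \<bar>T x\<bar>) - q \<le> 2 * Esigns A f"
    using Esigns_linear_square[OF A, of b] by (simp add: T_def q)
  moreover have "2 * \<bar>a j\<bar> * (sqrt q / sqrt 2) \<le> 2 * \<bar>a j\<bar> * Esigns A (\<lambda>x. \<bar>T x\<bar>)"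
    using khinchine_szarek[OF A, of b] by (intro mult_left_mono) (auto simp: T_def q)
  moreover have "2 * \<bar>a j\<bar> * (sqrt q / sqrt 2) = sqrt 2 * \<bar>a j\<bar> * sqrt q"
  proof -
    have "2 * \<bar>a j\<bar> * (sqrt q / sqrt 2) = (2 / sqrt 2) * \<bar>a j\<bar> * sqrt q" by simp
    then show ?thesis by (simp only: real_div_sqrt)
  qed
  ultimately have "(a i)\<^sup>2 - (a j)\<^sup>2 + sqrt 2 * \<bar>a j\<bar> * sqrt q - q \<le> 2 * Esigns A f"
    by linarith
  then show ?thesis
    unfolding f_def by simp
qed

lemma khinchine_two_coefficients:
  fixes a :: "'i \<Rightarrow> real"
  assumes A: "finite A" and ij: "i \<in> A" "j \<in> A" "i \<noteq> j" and unit: "(\<Sum>k\<in>A. (a k)\<^sup>2) = 1"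
  defines "K \<equiv> Esigns A (\<lambda>x. \<bar>\<Sum>k\<in>A. a k * x k\<bar>)"
    and "c \<equiv> sqrt (1 - (a i)\<^sup>2 - (a j)\<^sup>2)"
  shows "1 + ((a i)\<^sup>2 - (a j)\<^sup>2 + sqrt 2 * \<bar>a j\<bar> * c - c\<^sup>2) / 2 \<le> 2 * K\<^sup>2"
    and "1 + c * (sqrt 2 * (\<bar>a i\<bar> + \<bar>a j\<bar>) / 2 - c) \<le> 2 * K\<^sup>2"
proof -
  let ?D = "\<lambda>i. Esigns A (\<lambda>x. max 0 ((a i)\<^sup>2 - (\<Sum>k\<in>A - {i}. a k * x k)\<^sup>2))"
  have D_nonneg: "0 \<le> ?D k" for k
    by (rule Esigns_nonneg) simp
  have "?D i + ?D j = (\<Sum>k\<in>{i, j}. ?D k)" using ij by simp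
  also have "\<dots> \<le> (\<Sum>k\<in>A. ?D k)"
    using A ij D_nonneg by (intro sum_mono2) auto
  finally have K: "1 + ?D i + ?D j \<le> 2 * K\<^sup>2"
    using khinchine_deficit[OF A, of a] unfolding unit K_def by linarith
  have "(\<Sum>k\<in>A. (a k)\<^sup>2) = (a i)\<^sup>2 + ((a j)\<^sup>2 + (\<Sum>k\<in>A - {i, j}. (a k)\<^sup>2))"
    using A ij by (simp add: sum.remove[of A i] sum.remove[of "A - {i}" j] Diff_insert2[symmetric] insert_commute)
  then have q: "(\<Sum>k\<in>A - {i, j}. (a k)\<^sup>2) = 1 - (a i)\<^sup>2 - (a j)\<^sup>2"
    using unit by simp
  moreover have "0 \<le> (\<Sum>k\<in>A - {i, j}. (a k)\<^sup>2)" by (rule sum_nonneg) simp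
  ultimately have c2: "1 - (a i)\<^sup>2 - (a j)\<^sup>2 = c\<^sup>2" and c0: "0 \<le> c"
    by (simp_all add: c_def)
  have q': "(\<Sum>k\<in>A - {j, i}. (a k)\<^sup>2) = 1 - (a i)\<^sup>2 - (a j)\<^sup>2"
    using q by (simp add: insert_commute)
  have Di: "((a i)\<^sup>2 - (a j)\<^sup>2 + sqrt 2 * \<bar>a j\<bar> * c - c\<^sup>2) / 2 \<le> ?D i"
    using deficit_term_bound[OF A ij, of a] unfolding q c_def[symmetric] c2 using c0 by simp
  have Dj: "((a j)\<^sup>2 - (a i)\<^sup>2 + sqrt 2 * \<bar>a i\<bar> * c - c\<^sup>2) / 2 \<le> ?D j"
    using deficit_term_bound[OF A ij(2,1), of a] ij(3) unfolding q' c_def[symmetric] c2 using c0 by simp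
  show "1 + ((a i)\<^sup>2 - (a j)\<^sup>2 + sqrt 2 * \<bar>a j\<bar> * c - c\<^sup>2) / 2 \<le> 2 * K\<^sup>2"
    using K Di D_nonneg[of j] by linarith
  have "c * (sqrt 2 * (\<bar>a i\<bar> + \<bar>a j\<bar>) / 2 - c) =
      ((a i)\<^sup>2 - (a j)\<^sup>2 + sqrt 2 * \<bar>a j\<bar> * c - c\<^sup>2) / 2 +
      ((a j)\<^sup>2 - (a i)\<^sup>2 + sqrt 2 * \<bar>a i\<bar> * c - c\<^sup>2) / 2"
    by (simp add: power2_eq_square field_simps)
  then show "1 + c * (sqrt 2 * (\<bar>a i\<bar> + \<bar>a j\<bar>) / 2 - c) \<le> 2 * K\<^sup>2"
    using K Di Dj by linarith
qed

section \<open>Periodic functions against the kernel of inverse squares\<close>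

text \<open>
  The logarithmic derivative of Euler's reflection formula.
\<close>
lemma Digamma_reflection_real:
  fixes x :: real
  assumes "0 < x" "x < 1"
  shows "Digamma x - Digamma (1 - x) = - pi * cos (pi * x) / sin (pi * x)"
proof -
  have sin_pos: "0 < sin (pi * y)" if "0 < y" "y < 1" for y
    using that by (intro sin_gt_zero) auto
  have eq: "ln_Gamma y + ln_Gamma (1 - y) = ln pi - ln (sin (pi * y))" if y: "0 < y" "y < 1" for y :: real
  proof -
    have "complex_of_real (Gamma y * Gamma (1 - y)) = complex_of_real (pi / sin (pi * y))"
      using Gamma_reflection_complex[of "complex_of_real y"]
      by (simp add: Gamma_complex_of_real[symmetric] sin_of_real[symmetric])
    then have "Gamma y * Gamma (1 - y) = pi / sin (pi * y)"
      by (simp only: of_real_eq_iff)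
    then have "ln (Gamma y * Gamma (1 - y)) = ln (pi / sin (pi * y))"
      by simp
    then show ?thesis
      using y sin_pos[OF y] Gamma_real_pos[of y] Gamma_real_pos[of "1 - y"]
      by (simp add: ln_Gamma_real_pos ln_mult ln_div less_imp_neq[symmetric])
  qed
  have 1: "((\<lambda>y. ln_Gamma y + ln_Gamma (1 - y)) has_field_derivative
      Digamma x - Digamma (1 - x)) (at x)"
    using assms by (auto intro!: derivative_eq_intros)
  have 2: "((\<lambda>y. ln pi - ln (sin (pi * y))) has_field_derivative
      - pi * cos (pi * x) / sin (pi * x)) (at x)"
    using sin_pos[OF assms] by (auto intro!: derivative_eq_intros simp: field_simps)
  have "((\<lambda>y. ln pi - ln (sin (pi * y))) has_field_derivative Digamma x - Digamma (1 - x)) (at x)"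
    by (rule has_field_derivative_transform_within_open[OF 1, of "{0<..<1}"])
      (use assms eq in auto)
  then show ?thesis
    using 2 by (rule DERIV_unique)
qed

text \<open>
  The partial fraction expansion of \<open>1 / sin\<^sup>2\<close>, obtained by differentiating the reflection formula
  of the digamma function.  The two summands collect the poles to the left and to the right.
\<close>
lemma inverse_sin_square_sums:
  fixes x :: real
  assumes "0 < x" "x < 1"
  shows "(\<lambda>k. 1 / (x + of_nat k)\<^sup>2 + 1 / (1 - x + of_nat k)\<^sup>2) sums (pi\<^sup>2 / (sin (pi * x))\<^sup>2)"
proof -
  have sin_pos: "0 < sin (pi * x)"
    using assms by (intro sin_gt_zero) auto
  have ni: "y \<notin> \<int>\<^sub>\<le>\<^sub>0" if "0 < y" for y :: real
    using that nonpos_Ints_nonpos[of y] by auto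
  have 1: "((\<lambda>y. Digamma y - Digamma (1 - y)) has_field_derivative
      Polygamma 1 x + Polygamma 1 (1 - x)) (at x)"
    using assms by (auto intro!: derivative_eq_intros DERIV_chain2[of "Digamma"] simp: ni)
  have "pi * pi * (cos (pi * x) * cos (pi * x)) + pi * pi * (sin (pi * x) * sin (pi * x)) = pi * pi"
    using sin_cos_squared_add2[of "pi * x"] by (simp add: power2_eq_square distrib_left[symmetric])
  then have 2: "((\<lambda>y. - pi * cos (pi * y) / sin (pi * y)) has_field_derivative
      pi\<^sup>2 / (sin (pi * x))\<^sup>2) (at x)"
    using sin_pos by (auto intro!: derivative_eq_intros simp: power2_eq_square field_simps) algebra
  have "((\<lambda>y. - pi * cos (pi * y) / sin (pi * y)) has_field_derivative
      Polygamma 1 x + Polygamma 1 (1 - x)) (at x)"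
    by (rule has_field_derivative_transform_within_open[OF 1, of "{0<..<1}"])
      (use assms Digamma_reflection_real in auto)
  then have "Polygamma 1 x + Polygamma 1 (1 - x) = pi\<^sup>2 / (sin (pi * x))\<^sup>2"
    using 2 by (rule DERIV_unique)
  moreover have "(\<lambda>k. inverse ((x + of_nat k)\<^sup>2)) sums Polygamma 1 x"
    using Polygamma_LIMSEQ[of x 1] assms by (simp add: numeral_2_eq_2)
  moreover have "(\<lambda>k. inverse ((1 - x + of_nat k)\<^sup>2)) sums Polygamma 1 (1 - x)"
    using Polygamma_LIMSEQ[of "1 - x" 1] assms by (simp add: numeral_2_eq_2)
  ultimately show ?thesis
    by (metis (no_types, lifting) sums_add sums_cong inverse_eq_divide)
qed

text \<open>
  The half-line is cut into intervals of length \<open>\<pi>/2\<close>, each of which is carried to \<open>(0, \<pi>/2)\<close> by a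
  translation or a reflection under which \<open>h\<close> is invariant.  The factors \<open>1 / t\<^sup>2\<close> then add up to
  \<open>1 / sin\<^sup>2\<close>.  Working with nonnegative integrals avoids all questions of convergence.
\<close>
lemma nn_integral_periodic_over_square:
  fixes h :: "real \<Rightarrow> real"
  assumes [measurable]: "h \<in> borel_measurable borel"
    and nonneg: "\<And>t. 0 \<le> h t"
    and per: "\<And>t. h (t + pi) = h t" and even: "\<And>t. h (- t) = h t"
  shows "(\<integral>\<^sup>+t\<in>{0<..}. ennreal (h t / t\<^sup>2) \<partial>lborel) =
    (\<integral>\<^sup>+t\<in>{0<..<pi/2}. ennreal (h t / (sin t)\<^sup>2) \<partial>lborel)"
proof -
  let ?g = "\<lambda>u. ennreal (h (pi * u) / u\<^sup>2)"
  have hk: "h (pi * (u + real k)) = h (pi * u)" for u k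
  proof (induction k)
    case (Suc k)
    then show ?case using per[of "pi * (u + real k)"] by (simp add: algebra_simps)
  qed simp
  have hr: "h (pi * (1 + real k - u)) = h (pi * u)" for u k
    using hk[of "- u" "Suc k"] even[of "pi * u"] by (simp add: algebra_simps)
  \<comment> \<open>One period, in the variable \<open>u = t / \<pi>\<close>: its right half is reflected at \<open>k + 1\<close>.\<close>
  have piece: "(\<integral>\<^sup>+u\<in>{real k<..real k + 1}. ?g u \<partial>lborel) = (\<integral>\<^sup>+u\<in>{0<..<1/2}.
      ennreal (h (pi * u) * (1 / (u + real k)\<^sup>2 + 1 / (1 - u + real k)\<^sup>2)) \<partial>lborel)" for k
  proof -
    have "(\<integral>\<^sup>+u\<in>{real k<..real k + 1}. ?g u \<partial>lborel) =
       (\<integral>\<^sup>+u. ?g u * indicator {real k<..<real k + 1/2} u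
            + ?g u * indicator {real k + 1/2<..<real k + 1} u \<partial>lborel)"
      using AE_lborel_singleton[of "real k + 1/2"] AE_lborel_singleton[of "real k + 1"]
      by (intro nn_integral_cong_AE) (auto elim!: eventually_elim2 split: split_indicator)
    also have "\<dots> = (\<integral>\<^sup>+u. ?g u * indicator {real k<..<real k + 1/2} u \<partial>lborel)
            + (\<integral>\<^sup>+u. ?g u * indicator {real k + 1/2<..<real k + 1} u \<partial>lborel)"
      by (rule nn_integral_add) auto
    also have "(\<integral>\<^sup>+u. ?g u * indicator {real k<..<real k + 1/2} u \<partial>lborel) =
        (\<integral>\<^sup>+u\<in>{0<..<1/2}. ennreal (h (pi * u) * (1 / (u + real k)\<^sup>2)) \<partial>lborel)"
      by (subst nn_integral_real_affine[where c = 1 and t = "real k"])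
        (auto intro!: nn_integral_cong simp: hk add.commute[of "real k"] split: split_indicator)
    also have "(\<integral>\<^sup>+u. ?g u * indicator {real k + 1/2<..<real k + 1} u \<partial>lborel) =
        (\<integral>\<^sup>+u\<in>{0<..<1/2}. ennreal (h (pi * u) * (1 / (1 - u + real k)\<^sup>2)) \<partial>lborel)"
      by (subst nn_integral_real_affine[where c = "-1" and t = "1 + real k"])
        (auto intro!: nn_integral_cong simp: hr diff_add_eq split: split_indicator)
    also have "(\<integral>\<^sup>+u\<in>{0<..<1/2}. ennreal (h (pi * u) * (1 / (u + real k)\<^sup>2)) \<partial>lborel) +
       (\<integral>\<^sup>+u\<in>{0<..<1/2}. ennreal (h (pi * u) * (1 / (1 - u + real k)\<^sup>2)) \<partial>lborel) =
       (\<integral>\<^sup>+u\<in>{0<..<1/2}.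
      ennreal (h (pi * u) * (1 / (u + real k)\<^sup>2 + 1 / (1 - u + real k)\<^sup>2)) \<partial>lborel)"
      by (subst nn_integral_add[symmetric])
        (auto intro!: nn_integral_cong simp: nonneg ennreal_plus[symmetric] distrib_left
          simp del: ennreal_plus split: split_indicator)
    finally show ?thesis .
  qed
  have un: "(\<Union>k. {real k<..real k + 1}) = {0<..}"
  proof -
    { fix u :: real assume u: "0 < u"
      then have "0 \<le> \<lceil>u\<rceil> - 1" by simp
      then have "real (nat (\<lceil>u\<rceil> - 1)) = of_int \<lceil>u\<rceil> - 1" by simp
      then have "real (nat (\<lceil>u\<rceil> - 1)) < u \<and> u \<le> real (nat (\<lceil>u\<rceil> - 1)) + 1"
        by linarith
      then have "\<exists>k::nat. real k < u \<and> u \<le> real k + 1" by blast }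
    then show ?thesis by (auto intro: le_less_trans[rotated])
  qed
  have disj: "disjoint_family (\<lambda>k. {real k<..real k + 1})"
    unfolding disjoint_family_on_def
  proof (intro ballI impI)
    fix m n :: nat assume "m \<noteq> n"
    then have "real m + 1 \<le> real n \<or> real n + 1 \<le> real m" by linarith
    then show "{real m<..real m + 1} \<inter> {real n<..real n + 1} = {}" by auto
  qed
  have "(\<integral>\<^sup>+t\<in>{0<..}. ennreal (h t / t\<^sup>2) \<partial>lborel) =
     ennreal pi * (\<integral>\<^sup>+u. ennreal (h (pi * u) / (pi * u)\<^sup>2) * indicator {0<..} (pi * u) \<partial>lborel)"
    by (subst nn_integral_real_affine[where c = pi and t = 0]) auto
  also have "(\<integral>\<^sup>+u. ennreal (h (pi * u) / (pi * u)\<^sup>2) * indicator {0<..} (pi * u) \<partial>lborel) =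
     (\<integral>\<^sup>+u. ennreal (1 / pi\<^sup>2) * (?g u * indicator {0<..} u) \<partial>lborel)"
    by (auto intro!: nn_integral_cong simp: zero_less_mult_iff power_mult_distrib
        ennreal_mult'[symmetric] split: split_indicator)
  also have "\<dots> = ennreal (1 / pi\<^sup>2) * (\<integral>\<^sup>+u\<in>{0<..}. ?g u \<partial>lborel)"
    by (rule nn_integral_cmult) auto
  also have "(\<integral>\<^sup>+u\<in>{0<..}. ?g u \<partial>lborel) = (\<Sum>k. \<integral>\<^sup>+u\<in>{real k<..real k + 1}. ?g u \<partial>lborel)"
    unfolding un[symmetric] by (rule nn_integral_disjoint_family) (auto simp: disj)
  also have "\<dots> = (\<integral>\<^sup>+u. (\<Sum>k. ennreal (h (pi * u) * (1 / (u + real k)\<^sup>2 + 1 / (1 - u + real k)\<^sup>2))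
      * indicator {0<..<1/2} u) \<partial>lborel)"
    unfolding piece by (rule nn_integral_suminf[symmetric]) auto
  also have "\<dots> = (\<integral>\<^sup>+u\<in>{0<..<1/2}. ennreal (h (pi * u) * (pi\<^sup>2 / (sin (pi * u))\<^sup>2)) \<partial>lborel)"
  proof (rule nn_integral_cong)
    fix u :: real
    show "(\<Sum>k. ennreal (h (pi * u) * (1 / (u + real k)\<^sup>2 + 1 / (1 - u + real k)\<^sup>2))
      * indicator {0<..<1/2} u) =
      ennreal (h (pi * u) * (pi\<^sup>2 / (sin (pi * u))\<^sup>2)) * indicator {0<..<1/2} u"
    proof (cases "u \<in> {0<..<1/2}")
      case True
      then have "(\<lambda>k. h (pi * u) * (1 / (u + real k)\<^sup>2 + 1 / (1 - u + real k)\<^sup>2)) sums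
          (h (pi * u) * (pi\<^sup>2 / (sin (pi * u))\<^sup>2))"
        by (intro sums_mult inverse_sin_square_sums) auto
      then have "(\<Sum>k. ennreal (h (pi * u) * (1 / (u + real k)\<^sup>2 + 1 / (1 - u + real k)\<^sup>2))) =
          ennreal (h (pi * u) * (pi\<^sup>2 / (sin (pi * u))\<^sup>2))"
        using nonneg by (intro suminf_ennreal_eq) auto
      with True show ?thesis by simp
    qed simp
  qed
  also have "ennreal pi * (ennreal (1 / pi\<^sup>2) * \<dots>) =
     ennreal pi * (\<integral>\<^sup>+u. ennreal (h (pi * u) / (sin (pi * u))\<^sup>2) * indicator {0<..<pi/2} (pi * u) \<partial>lborel)"
    by (subst nn_integral_cmult[symmetric])
      (auto intro!: arg_cong[where f = "\<lambda>x. ennreal pi * x"] nn_integral_cong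
        simp: ennreal_mult'[symmetric] zero_less_mult_iff split: split_indicator)
  also have "\<dots> = (\<integral>\<^sup>+t\<in>{0<..<pi/2}. ennreal (h t / (sin t)\<^sup>2) \<partial>lborel)"
    by (subst nn_integral_real_affine[where c = pi and t = 0 and f = "\<lambda>t. ennreal (h t / (sin t)\<^sup>2) * indicator {0<..<pi/2} t"]) auto
  finally show ?thesis .
qed

section \<open>Wallis integrals with a real exponent\<close>

definition wallis :: "real \<Rightarrow> real" where
  "wallis s = integral {0..pi/2} (\<lambda>x. cos x powr s)"

lemma cos_powr_continuous: "0 < s \<Longrightarrow> continuous_on {0..pi/2} (\<lambda>x. cos x powr s)"
  by (intro continuous_on_powr' continuous_intros) (auto intro: cos_ge_zero)

lemma wallis_has_integral: "0 < s \<Longrightarrow> ((\<lambda>x. cos x powr s) has_integral wallis s) {0..pi/2}"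
  unfolding wallis_def by (intro integrable_integral integrable_continuous_interval cos_powr_continuous)

text \<open>
  Integration by parts against the primitive \<open>- cot\<close> of \<open>1 / sin\<^sup>2\<close>.  The boundary terms vanish: at 0
  because \<open>1 - cos\<^sup>s\<close> is of second order there, at \<open>\<pi>/2\<close> because of the cosine.
\<close>
lemma wallis_by_parts:
  assumes s: "0 < s"
  shows "((\<lambda>x. (1 - cos x powr s) / (sin x)\<^sup>2) has_integral s * wallis s) {0..pi/2}"
proof -
  let ?G = "\<lambda>x. - (cos x * ((1 - cos x powr s) / sin x))"
  have pos: "0 < cos x" "0 < sin x" if "x \<in> {0<..<pi/2}" for x
    using that by (auto intro: cos_gt_zero sin_gt_zero)
  have at0: "((\<lambda>x. (1 - cos x powr s) / sin x) \<longlongrightarrow> 0) (at 0)"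
  proof -
    have "((\<lambda>x. 1 - cos x powr s) has_field_derivative 0) (at 0)"
      by (auto intro!: derivative_eq_intros)
    then have n: "((\<lambda>x. (1 - cos x powr s) / x) \<longlongrightarrow> 0) (at 0)"
      by (simp add: has_field_derivative_iff)
    have "(sin has_field_derivative 1) (at (0::real))"
      by (auto intro!: derivative_eq_intros)
    then have d: "((\<lambda>x. sin x / x) \<longlongrightarrow> 1) (at (0::real))"
      by (simp add: has_field_derivative_iff)
    have "((\<lambda>x. ((1 - cos x powr s) / x) / (sin x / x)) \<longlongrightarrow> 0 / 1) (at 0)"
      by (intro tendsto_divide n d) simp
    moreover have ev: "\<forall>\<^sub>F x in at 0. ((1 - cos x powr s) / x) / (sin x / x) = (1 - cos x powr s) / sin x"
      by (auto simp: eventually_at_filter)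
    ultimately show ?thesis
      unfolding tendsto_cong[OF ev] by simp
  qed
  have cont: "continuous_on {0..pi/2} ?G"
    unfolding continuous_on_def
  proof
    fix x assume x: "x \<in> {0..pi/2}"
    show "(?G \<longlongrightarrow> ?G x) (at x within {0..pi/2})"
    proof (cases "x = 0")
      case True
      have "(?G \<longlongrightarrow> - (cos 0 * 0)) (at 0)"
        by (intro tendsto_intros at0)
      then show ?thesis
        using True by (auto intro: tendsto_within_subset)
    next
      case False
      then have "sin x \<noteq> 0" using x sin_gt_zero[of x] pi_gt_zero by auto
      moreover have "((\<lambda>x. cos x powr s) \<longlongrightarrow> cos x powr s) (at x within {0..pi/2})"
        using cos_powr_continuous[OF s] x by (simp add: continuous_on_def)
      ultimately show ?thesis
        by (auto intro!: tendsto_intros)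
    qed
  qed
  have deriv: "(?G has_vector_derivative (1 - cos x powr s) / (sin x)\<^sup>2 - s * cos x powr s) (at x)"
    if x: "x \<in> {0<..<pi/2}" for x
  proof -
    note p = pos[OF x]
    have cs: "cos x powr (s - 1) * cos x = cos x powr s"
      using p by (simp add: powr_diff)
    have "((\<lambda>x. cos x powr s) has_field_derivative - (s * cos x powr (s - 1) * sin x)) (at x)"
      using p by (auto intro!: derivative_eq_intros simp: powr_diff)
    then have "(?G has_field_derivative
      - (- sin x * ((1 - cos x powr s) / sin x) + cos x * (((s * cos x powr (s - 1) * sin x) * sin x -
        (1 - cos x powr s) * cos x) / (sin x * sin x)))) (at x)"
      using p by (auto intro!: derivative_eq_intros) (simp add: field_simps)
    also have "- (- sin x * ((1 - cos x powr s) / sin x) + cos x * (((s * cos x powr (s - 1) * sin x) * sin x -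
        (1 - cos x powr s) * cos x) / (sin x * sin x))) =
        (1 - cos x powr s) / (sin x)\<^sup>2 - s * (cos x powr (s - 1) * cos x)"
    proof -
      have "- (- S * ((1 - P) / S) + C * (((s * Q * S) * S - (1 - P) * C) / (S * S))) =
          (1 - P) / S\<^sup>2 - s * (Q * C)" if "S \<noteq> 0" "S * S + C * C = 1" for S C P Q :: real
        using that by (simp add: power2_eq_square field_simps) algebra
      then show ?thesis
        using p by (simp add: power2_eq_square[symmetric])
    qed
    finally show ?thesis
      by (simp add: cs has_real_derivative_iff_has_vector_derivative)
  qed
  have "((\<lambda>x. (1 - cos x powr s) / (sin x)\<^sup>2 - s * cos x powr s) has_integral ?G (pi/2) - ?G 0) {0..pi/2}"
    by (rule fundamental_theorem_of_calculus_interior) (use cont deriv in auto)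
  then have "((\<lambda>x. (1 - cos x powr s) / (sin x)\<^sup>2 - s * cos x powr s + s * cos x powr s)
      has_integral 0 + s * wallis s) {0..pi/2}"
    by (intro has_integral_add has_integral_mult_right wallis_has_integral s) simp
  then show ?thesis by simp
qed

lemma wallis_nn_integral:
  assumes s: "0 < s"
  shows "(\<integral>\<^sup>+x\<in>{0<..<pi/2}. ennreal ((1 - \<bar>cos x\<bar> powr s) / (sin x)\<^sup>2) \<partial>lborel) = ennreal (s * wallis s)"
proof -
  let ?f = "\<lambda>x. (1 - \<bar>cos x\<bar> powr s) / (sin x)\<^sup>2"
  have "(?f has_integral s * wallis s) {0<..<pi/2}"
    using wallis_by_parts[OF s] unfolding has_integral_Icc_iff_Ioo
  proof (rule has_integral_eq[rotated])
    fix x :: real assume "x \<in> {0<..<pi/2}"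
    then have "0 < cos x" by (intro cos_gt_zero) auto
    then show "(1 - cos x powr s) / (sin x)\<^sup>2 = ?f x" by simp
  qed
  then have "((\<lambda>x. ?f x * indicator {0<..<pi/2} x) has_integral s * wallis s) UNIV"
    by (subst (asm) has_integral_restrict_UNIV[symmetric])
      (simp add: indicator_def of_bool_def if_distrib cong: if_cong)
  then have "(\<integral>\<^sup>+x. ennreal (?f x * indicator {0<..<pi/2} x) \<partial>lborel) = ennreal (s * wallis s)"
    by (intro nn_integral_has_integral_lborel)
      (auto intro!: divide_nonneg_nonneg powr_le_one_le mult_nonneg_nonneg simp: powr_le1 s less_imp_le)
  moreover have "ennreal (?f x * indicator {0<..<pi/2} x) = ennreal (?f x) * indicator {0<..<pi/2} x" for x
    by (simp split: split_indicator)
  ultimately show ?thesis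
    by simp
qed

text \<open>
  Wallis' recursion follows by subtracting the identity above for \<open>s\<close> from that for \<open>s + 2\<close>, as
  \<open>cos\<^sup>s - cos\<^bsup>s+2\<^esup> = cos\<^sup>s * sin\<^sup>2\<close>.
\<close>
lemma wallis_plus_2:
  assumes s: "0 < s"
  shows "wallis (s + 2) = (s + 1) / (s + 2) * wallis s"
proof -
  have "((\<lambda>x. (1 - cos x powr (s + 2)) / (sin x)\<^sup>2 - (1 - cos x powr s) / (sin x)\<^sup>2)
      has_integral (s + 2) * wallis (s + 2) - s * wallis s) {0<..<pi/2}"
    unfolding has_integral_Icc_iff_Ioo[symmetric]
    using s by (intro has_integral_diff wallis_by_parts) auto
  moreover have "(1 - cos x powr (s + 2)) / (sin x)\<^sup>2 - (1 - cos x powr s) / (sin x)\<^sup>2 = cos x powr s"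
    if x: "x \<in> {0<..<pi/2}" for x
  proof -
    have "0 < cos x" "0 < sin x"
      using x by (auto intro: cos_gt_zero sin_gt_zero)
    moreover have "(cos x)\<^sup>2 = 1 - (sin x)\<^sup>2" by (simp add: cos_squared_eq)
    ultimately show ?thesis
      by (simp add: powr_add powr_numeral diff_divide_distrib[symmetric])
        (simp add: field_simps)
  qed
  ultimately have "((\<lambda>x. cos x powr s) has_integral (s + 2) * wallis (s + 2) - s * wallis s) {0<..<pi/2}"
    by (rule has_integral_eq[rotated])
  then have "(s + 2) * wallis (s + 2) - s * wallis s = wallis s"
    using wallis_has_integral[OF s] unfolding has_integral_Icc_iff_Ioo by (rule has_integral_unique)
  then show ?thesis
    using s by (simp add: field_simps)
qed

lemma wallis_1: "wallis 1 = 1"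
proof -
  have "(cos has_integral sin (pi/2) - sin 0) {0..pi/2}"
    by (rule fundamental_theorem_of_calculus)
      (auto intro!: derivative_eq_intros simp: has_real_derivative_iff_has_vector_derivative[symmetric])
  moreover have "cos x powr 1 = cos x" if "x \<in> {0..pi/2}" for x
    using that cos_ge_zero[of x] by simp
  ultimately have "((\<lambda>x. cos x powr 1) has_integral 1) {0..pi/2}"
    by (auto intro: has_integral_eq[rotated])
  with wallis_has_integral[of 1] show ?thesis
    by (auto dest: has_integral_unique)
qed

lemma wallis_2: "wallis 2 = pi / 4"
proof -
  have "((\<lambda>x. 1::real) has_integral 2 * wallis 2) {0<..<pi/2}"
  proof (rule has_integral_eq)
    show "((\<lambda>x. (1 - cos x powr 2) / (sin x)\<^sup>2) has_integral 2 * wallis 2) {0<..<pi/2}"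
      using wallis_by_parts[of 2] by (simp add: has_integral_Icc_iff_Ioo)
    fix x :: real assume x: "x \<in> {0<..<pi/2}"
    then have "0 < cos x" "0 < sin x"
      by (auto intro: cos_gt_zero sin_gt_zero)
    then show "(1 - cos x powr 2) / (sin x)\<^sup>2 = 1"
      by (simp add: sin_squared_eq[symmetric])
  qed
  moreover have "((\<lambda>x. 1::real) has_integral pi / 2) {0<..<pi/2}"
    unfolding has_integral_Icc_iff_Ioo[symmetric] using has_integral_const_real[of "1::real" 0 "pi/2"] by simp
  ultimately have "2 * wallis 2 = pi / 2"
    by (rule has_integral_unique)
  then show ?thesis by simp
qed

text \<open>
  Equivalently \<open>ln (cos y) / y\<^sup>2\<close> is decreasing.  After taking logarithms and differentiating in \<open>y\<close>
  the claim becomes \<open>tan (c * y) \<le> c * tan y\<close>, and a second differentiation reduces that to the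
  monotonicity of the cosine.
\<close>
lemma cos_powr_le_cos_scaled:
  assumes c: "0 \<le> c" "c \<le> 1" and y: "0 \<le> y" "y < pi / 2"
  shows "cos y powr (c\<^sup>2) \<le> cos (c * y)"
proof -
  have cx: "0 \<le> c * x" "c * x \<le> x" "c * x < pi / 2" if "0 \<le> x" "x < pi/2" for x
  proof -
    show "0 \<le> c * x" using c that by simp
    show "c * x \<le> x" using c that by (simp add: mult_left_le_one_le)
    with that show "c * x < pi / 2" by simp
  qed
  have pos: "0 < cos x" "0 < cos (c * x)" "cos x \<le> cos (c * x)" if "0 \<le> x" "x < pi/2" for x
    using cx[OF that] that pi_gt_zero by (auto intro!: cos_gt_zero_pi cos_monotone_0_pi_le)
  have tan: "tan (c * x) \<le> c * tan x" if x: "0 \<le> x" "x < pi/2" for x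
  proof -
    have "c * tan 0 - tan (c * 0) \<le> c * tan x - tan (c * x)"
    proof (rule DERIV_nonneg_imp_nondecreasing[OF x(1)])
      fix z assume z: "0 \<le> z" "z \<le> x"
      then have z': "0 \<le> z" "z < pi/2" using x by auto
      have "((\<lambda>x. c * tan x - tan (c * x)) has_field_derivative
          c * (inverse ((cos z)\<^sup>2) - inverse ((cos (c * z))\<^sup>2))) (at z)"
        using pos[OF z'] by (auto intro!: derivative_eq_intros simp: algebra_simps)
      moreover have "0 \<le> c * (inverse ((cos z)\<^sup>2) - inverse ((cos (c * z))\<^sup>2))"
        using pos[OF z'] c by (intro mult_nonneg_nonneg) (auto intro!: le_imp_inverse_le power_mono)
      ultimately show "\<exists>d. ((\<lambda>x. c * tan x - tan (c * x)) has_field_derivative d) (at z) \<and> 0 \<le> d"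
        by blast
    qed
    then show ?thesis by simp
  qed
  have "ln (cos (c * 0)) - c\<^sup>2 * ln (cos 0) \<le> ln (cos (c * y)) - c\<^sup>2 * ln (cos y)"
  proof (rule DERIV_nonneg_imp_nondecreasing[OF y(1)])
    fix z assume z: "0 \<le> z" "z \<le> y"
    then have z': "0 \<le> z" "z < pi/2" using y by auto
    have "((\<lambda>y. ln (cos (c * y)) - c\<^sup>2 * ln (cos y)) has_field_derivative
        c * (c * tan z - tan (c * z))) (at z)"
      using pos[OF z'] by (auto intro!: derivative_eq_intros simp: tan_def power2_eq_square field_simps)
    moreover have "0 \<le> c * (c * tan z - tan (c * z))"
      using tan[OF z'] c by simp
    ultimately show "\<exists>d. ((\<lambda>y. ln (cos (c * y)) - c\<^sup>2 * ln (cos y)) has_field_derivative d) (at z) \<and> 0 \<le> d"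
      by blast
  qed
  then have "c\<^sup>2 * ln (cos y) \<le> ln (cos (c * y))" by simp
  then have "exp (c\<^sup>2 * ln (cos y)) \<le> cos (c * y)"
    using pos[OF y] by (metis exp_ln exp_le_cancel_iff)
  then show ?thesis
    using pos[OF y] by (simp add: powr_def)
qed

text \<open>
  With \<open>c = sqrt (m / s)\<close>, the substitution \<open>x = c * y\<close> turns the integral of \<open>cos\<^sup>s\<close> over
  \<open>(0, c * \<pi>/2)\<close> into \<open>c\<close> times that of \<open>cos (c * y)\<^sup>s\<close>, which dominates \<open>cos\<^sup>m\<close> pointwise by the
  previous lemma.
\<close>
lemma sqrt_wallis_mono:
  assumes m: "0 < m" and s: "m \<le> s"
  shows "sqrt m * wallis m \<le> sqrt s * wallis s"
proof -
  define c where "c = sqrt (m / s)"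
  have c: "0 < c" "c \<le> 1" using m s by (auto simp: c_def)
  have c2: "c\<^sup>2 * s = m" using m s by (simp add: c_def)
  have int: "(\<lambda>x. cos x powr s) integrable_on {0..pi/2}"
    using m s by (intro integrable_continuous_interval cos_powr_continuous) auto
  have sub: "{0..c * (pi/2)} \<subseteq> {0..pi/2}"
    using c by (simp add: mult_left_le_one_le)
  then have int': "(\<lambda>x. cos x powr s) integrable_on {0..c * (pi/2)}"
    by (rule integrable_on_subinterval[OF int])
  then have "((\<lambda>x. cos x powr s) has_integral integral {0..c * (pi/2)} (\<lambda>x. cos x powr s)) {0..c * (pi/2)}"
    by (rule integrable_integral)
  from has_integral_stretch_real[OF this, of c]
  have st: "((\<lambda>x. cos (c * x) powr s) has_integral
      (1 / c) * integral {0..c * (pi/2)} (\<lambda>x. cos x powr s)) {0..pi/2}"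
    using c by (simp add: image_divide_atLeastAtMost)
  have "wallis m \<le> (1 / c) * integral {0..c * (pi/2)} (\<lambda>x. cos x powr s)"
  proof (rule has_integral_le[OF wallis_has_integral[OF m] st])
    fix x assume x: "x \<in> {0..pi/2}"
    show "cos x powr m \<le> cos (c * x) powr s"
    proof (cases "x = pi / 2")
      case True
      then have "cos x = 0" by (simp only: cos_pi_half)
      then show ?thesis by simp
    next
      case False
      then have "cos x powr (c\<^sup>2) \<le> cos (c * x)"
        using x c by (intro cos_powr_le_cos_scaled) auto
      then have "(cos x powr (c\<^sup>2)) powr s \<le> cos (c * x) powr s"
        using m s by (intro powr_mono2) auto
      then show ?thesis by (simp add: powr_powr c2)
    qed
  qed
  also have "\<dots> \<le> (1 / c) * wallis s"
    unfolding wallis_def using c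
    by (intro mult_left_mono integral_subset_le[OF sub int' int]) auto
  finally have "c * wallis m \<le> wallis s"
    using c by (simp add: field_simps)
  then have "sqrt s * (c * wallis m) \<le> sqrt s * wallis s"
    using m s by (intro mult_left_mono) auto
  moreover have "sqrt s * c = sqrt m"
    using m s by (simp add: c_def real_sqrt_mult[symmetric])
  ultimately show ?thesis
    by (simp add: mult.assoc[symmetric])
qed

text \<open>
  The weighted inequality between the arithmetic and geometric means, applied to the numbers
  \<open>y i powr (1 / p i)\<close>.
\<close>
lemma prod_le_weighted_sum_powr:
  fixes p y :: "'i \<Rightarrow> real"
  assumes S: "finite S" "(\<Sum>i\<in>S. p i) = 1" and p: "\<And>i. i \<in> S \<Longrightarrow> 0 < p i"
    and y: "\<And>i. i \<in> S \<Longrightarrow> 0 \<le> y i"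
  shows "(\<Prod>i\<in>S. y i) \<le> (\<Sum>i\<in>S. p i * y i powr (1 / p i))"
proof (cases "\<exists>i\<in>S. y i = 0")
  case True
  then have "(\<Prod>i\<in>S. y i) = 0" using S by auto
  moreover have "0 \<le> (\<Sum>i\<in>S. p i * y i powr (1 / p i))"
    using p by (intro sum_nonneg mult_nonneg_nonneg) (auto intro: less_imp_le)
  ultimately show ?thesis by simp
next
  case False
  then have y: "0 < y i" if "i \<in> S" for i using y[OF that] that by force
  have ne: "S \<noteq> {}" using S by auto
  let ?u = "\<lambda>i. ln (y i) / p i"
  have "exp (\<Sum>i\<in>S. p i *\<^sub>R ?u i) \<le> (\<Sum>i\<in>S. p i * exp (?u i))"
    by (rule convex_on_sum[OF S(1) ne exp_convex S(2)]) (auto intro: p less_imp_le)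
  moreover have "(\<Sum>i\<in>S. p i *\<^sub>R ?u i) = (\<Sum>i\<in>S. ln (y i))"
    using p by (intro sum.cong) (auto dest: less_imp_neq[symmetric])
  moreover have "exp (\<Sum>i\<in>S. ln (y i)) = (\<Prod>i\<in>S. y i)"
    using S y by (simp add: exp_sum)
  moreover have "(\<Sum>i\<in>S. p i * exp (?u i)) = (\<Sum>i\<in>S. p i * y i powr (1 / p i))"
    using y by (intro sum.cong) (auto simp: powr_def dest: less_imp_neq[symmetric])
  ultimately show ?thesis by simp
qed

section \<open>The lower bound of Haagerup\<close>

lemma nn_integral_over_square_scale:
  fixes h :: "real \<Rightarrow> real"
  assumes [measurable]: "h \<in> borel_measurable borel"
    and even: "\<And>t. h (- t) = h t" and c: "c \<noteq> 0"
  shows "(\<integral>\<^sup>+t\<in>{0<..}. ennreal (h (c * t) / t\<^sup>2) \<partial>lborel) =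
    ennreal \<bar>c\<bar> * (\<integral>\<^sup>+t\<in>{0<..}. ennreal (h t / t\<^sup>2) \<partial>lborel)"
proof -
  have "(\<integral>\<^sup>+t\<in>{0<..}. ennreal (h (c * t) / t\<^sup>2) \<partial>lborel) =
      ennreal (1 / \<bar>c\<bar>) * (\<integral>\<^sup>+t. ennreal (h (c * (t / \<bar>c\<bar>)) / (t / \<bar>c\<bar>)\<^sup>2) * indicator {0<..} (t / \<bar>c\<bar>) \<partial>lborel)"
    using c by (subst nn_integral_real_affine[where c = "1 / \<bar>c\<bar>" and t = 0]) auto
  also have "(\<integral>\<^sup>+t. ennreal (h (c * (t / \<bar>c\<bar>)) / (t / \<bar>c\<bar>)\<^sup>2) * indicator {0<..} (t / \<bar>c\<bar>) \<partial>lborel) =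
      (\<integral>\<^sup>+t. ennreal (c\<^sup>2) * (ennreal (h t / t\<^sup>2) * indicator {0<..} t) \<partial>lborel)"
  proof (rule nn_integral_cong)
    fix t :: real
    have "h (c * (t / \<bar>c\<bar>)) = h t"
      using c even[of t] by (cases "0 < c") auto
    then show "ennreal (h (c * (t / \<bar>c\<bar>)) / (t / \<bar>c\<bar>)\<^sup>2) * indicator {0<..} (t / \<bar>c\<bar>) =
       ennreal (c\<^sup>2) * (ennreal (h t / t\<^sup>2) * indicator {0<..} t)"
      using c by (auto simp: zero_less_divide_iff power_divide ennreal_mult'[symmetric] mult.commute
          split: split_indicator)
  qed
  also have "\<dots> = ennreal (c\<^sup>2) * (\<integral>\<^sup>+t\<in>{0<..}. ennreal (h t / t\<^sup>2) \<partial>lborel)"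
    by (rule nn_integral_cmult) auto
  also have "ennreal (1 / \<bar>c\<bar>) * (ennreal (c\<^sup>2) * (\<integral>\<^sup>+t\<in>{0<..}. ennreal (h t / t\<^sup>2) \<partial>lborel)) =
      ennreal \<bar>c\<bar> * (\<integral>\<^sup>+t\<in>{0<..}. ennreal (h t / t\<^sup>2) \<partial>lborel)"
  proof -
    have "1 / \<bar>c\<bar> * c\<^sup>2 = \<bar>c\<bar>"
      using c by (simp add: power2_eq_square abs_if)
    then show ?thesis
      by (simp add: mult.assoc[symmetric] ennreal_mult'[symmetric])
  qed
  finally show ?thesis .
qed

text \<open>
  The integral representation of \<open>\<bar>s\<bar>\<close>.  Up to scaling the numerator is \<open>2 * sin\<^sup>2\<close>, so the integrand
  is constant after passing to the kernel \<open>1 / sin\<^sup>2\<close>.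
\<close>
lemma nn_integral_one_minus_cos:
  "(\<integral>\<^sup>+t\<in>{0<..}. ennreal ((1 - cos (t * s)) / t\<^sup>2) \<partial>lborel) = ennreal (pi / 2 * \<bar>s\<bar>)"
proof (cases "s = 0")
  case False
  have "(\<integral>\<^sup>+t\<in>{0<..}. ennreal ((1 - cos (2 * t)) / t\<^sup>2) \<partial>lborel) =
      (\<integral>\<^sup>+t\<in>{0<..<pi/2}. ennreal ((1 - cos (2 * t)) / (sin t)\<^sup>2) \<partial>lborel)"
    by (rule nn_integral_periodic_over_square) (auto simp: distrib_left)
  also have "\<dots> = (\<integral>\<^sup>+t. ennreal 2 * indicator {0<..<pi/2} t \<partial>lborel)"
  proof (rule nn_integral_cong)
    fix t :: real
    have "(1 - cos (2 * t)) / (sin t)\<^sup>2 = 2" if "t \<in> {0<..<pi/2}"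
      using that sin_gt_zero[of t] by (auto simp: cos_double_sin)
    then show "ennreal ((1 - cos (2 * t)) / (sin t)\<^sup>2) * indicator {0<..<pi/2} t =
        ennreal 2 * indicator {0<..<pi/2} t"
      by (simp split: split_indicator)
  qed
  also have "\<dots> = ennreal pi"
    by (simp add: nn_integral_cmult_indicator ennreal_mult'[symmetric] flip: ennreal_numeral)
  finally have 1: "(\<integral>\<^sup>+t\<in>{0<..}. ennreal ((1 - cos (2 * t)) / t\<^sup>2) \<partial>lborel) = ennreal pi" .
  have "(\<integral>\<^sup>+t\<in>{0<..}. ennreal ((1 - cos (2 * ((s / 2) * t))) / t\<^sup>2) \<partial>lborel) = ennreal \<bar>s / 2\<bar> * ennreal pi"
    unfolding 1[symmetric] using False
    by (intro nn_integral_over_square_scale[where h = "\<lambda>t. 1 - cos (2 * t)"]) auto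
  then show ?thesis
    by (simp add: ennreal_mult'[symmetric] mult.commute)
qed simp

lemma nn_integral_one_minus_cos_powr:
  assumes s: "0 < s"
  shows "(\<integral>\<^sup>+t\<in>{0<..}. ennreal ((1 - \<bar>cos (t * a)\<bar> powr s) / t\<^sup>2) \<partial>lborel) = ennreal (\<bar>a\<bar> * (s * wallis s))"
proof (cases "a = 0")
  case False
  have 1: "(\<integral>\<^sup>+t\<in>{0<..}. ennreal ((1 - \<bar>cos t\<bar> powr s) / t\<^sup>2) \<partial>lborel) = ennreal (s * wallis s)"
    unfolding wallis_nn_integral[OF s, symmetric]
    by (rule nn_integral_periodic_over_square) (use s in \<open>auto simp: powr_le1\<close>)
  have "(\<integral>\<^sup>+t\<in>{0<..}. ennreal ((1 - \<bar>cos (a * t)\<bar> powr s) / t\<^sup>2) \<partial>lborel) = ennreal \<bar>a\<bar> * ennreal (s * wallis s)"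
    unfolding 1[symmetric] using False
    by (intro nn_integral_over_square_scale[where h = "\<lambda>t. 1 - \<bar>cos t\<bar> powr s"]) auto
  then show ?thesis
    by (simp add: ennreal_mult'[symmetric] mult.commute)
qed simp

lemma Esigns_cos:
  assumes "finite A"
  shows "Esigns A (\<lambda>x. cos (t * (\<Sum>i\<in>A. a i * x i))) = (\<Prod>i\<in>A. cos (t * a i))"
proof -
  have "Esigns A (\<lambda>x. cos (c + t * (\<Sum>i\<in>A. a i * x i))) = cos c * (\<Prod>i\<in>A. cos (t * a i))" for c
    using assms
  proof (induction A arbitrary: c)
    case (insert i A)
    let ?S = "\<lambda>x. \<Sum>j\<in>A. a j * x j"
    have s: "(\<Sum>j\<in>A. a j * (x(i := r)) j) = ?S x" for x r
      using insert.hyps by (intro sum.cong) auto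
    have "Esigns (insert i A) (\<lambda>x. cos (c + t * (\<Sum>j\<in>insert i A. a j * x j))) =
       (Esigns A (\<lambda>x. cos (c + t * a i + t * ?S x)) + Esigns A (\<lambda>x. cos (c - t * a i + t * ?S x))) / 2"
      using insert.hyps by (simp add: Esigns_insert s del: fun_upd_apply) (simp add: algebra_simps)
    also have "\<dots> = (cos (c + t * a i) + cos (c - t * a i)) / 2 * (\<Prod>i\<in>A. cos (t * a i))"
      by (simp only: insert.IH) (simp add: algebra_simps)
    also have "(cos (c + t * a i) + cos (c - t * a i)) / 2 = cos c * cos (t * a i)"
      by (simp add: cos_add cos_diff)
    finally show ?case
      using insert.hyps by simp
  qed simp
  from this[of 0] show ?thesis by simp
qed

lemma sum_ennreal_mult:
  assumes "\<And>i. i \<in> S \<Longrightarrow> 0 \<le> c i" "\<And>i. i \<in> S \<Longrightarrow> 0 \<le> f i"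
  shows "(\<Sum>i\<in>S. ennreal (c i) * ennreal (f i)) = ennreal (\<Sum>i\<in>S. c i * f i)"
proof -
  have "(\<Sum>i\<in>S. ennreal (c i) * ennreal (f i)) = (\<Sum>i\<in>S. ennreal (c i * f i))"
    using assms(1) by (intro sum.cong refl ennreal_mult'[symmetric])
  also have "\<dots> = ennreal (\<Sum>i\<in>S. c i * f i)"
    using assms by (intro sum_ennreal mult_nonneg_nonneg)
  finally show ?thesis .
qed

lemma nn_integral_char_function:
  assumes A: "finite A"
  shows "(\<integral>\<^sup>+t\<in>{0<..}. ennreal ((1 - (\<Prod>i\<in>A. cos (t * a i))) / t\<^sup>2) \<partial>lborel) =
    ennreal (pi / 2 * Esigns A (\<lambda>x. \<bar>\<Sum>i\<in>A. a i * x i\<bar>))"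
proof -
  let ?S = "\<lambda>x. \<Sum>i\<in>A. a i * x i"
  let ?N = "2 ^ card A :: real"
  have "ennreal ((1 - (\<Prod>i\<in>A. cos (t * a i))) / t\<^sup>2) =
      (\<Sum>x\<in>signs A. ennreal (1 / ?N) * ennreal ((1 - cos (t * ?S x)) / t\<^sup>2))" for t
  proof -
    have "(1 - (\<Prod>i\<in>A. cos (t * a i))) / t\<^sup>2 = Esigns A (\<lambda>x. (1 - cos (t * ?S x)) / t\<^sup>2)"
      by (simp add: Esigns_divide Esigns_diff Esigns_const[OF A] Esigns_cos[OF A])
    also have "\<dots> = (\<Sum>x\<in>signs A. 1 / ?N * ((1 - cos (t * ?S x)) / t\<^sup>2))"
      by (simp add: Esigns_def sum_divide_distrib mult.commute)
    also have "ennreal \<dots> = (\<Sum>x\<in>signs A. ennreal (1 / ?N) * ennreal ((1 - cos (t * ?S x)) / t\<^sup>2))"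
      by (rule sum_ennreal_mult[symmetric]) auto
    finally show ?thesis .
  qed
  then have "(\<integral>\<^sup>+t\<in>{0<..}. ennreal ((1 - (\<Prod>i\<in>A. cos (t * a i))) / t\<^sup>2) \<partial>lborel) =
     (\<integral>\<^sup>+t. (\<Sum>x\<in>signs A. ennreal (1 / ?N) * (ennreal ((1 - cos (t * ?S x)) / t\<^sup>2) * indicator {0<..} t)) \<partial>lborel)"
    by (simp add: sum_distrib_right mult.assoc)
  also have "\<dots> = (\<Sum>x\<in>signs A. ennreal (1 / ?N) * ennreal (pi / 2 * \<bar>?S x\<bar>))"
    by (subst nn_integral_sum) (auto intro!: sum.cong simp: nn_integral_cmult nn_integral_one_minus_cos)
  also have "\<dots> = ennreal (\<Sum>x\<in>signs A. 1 / ?N * (pi / 2 * \<bar>?S x\<bar>))"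
    by (rule sum_ennreal_mult) auto
  also have "(\<Sum>x\<in>signs A. 1 / ?N * (pi / 2 * \<bar>?S x\<bar>)) = pi / 2 * Esigns A (\<lambda>x. \<bar>?S x\<bar>)"
    by (simp add: Esigns_def sum_distrib_left sum_divide_distrib mult.commute)
  finally show ?thesis .
qed

text \<open>
  The exponents \<open>1 / p i\<close> are what makes the geometric mean on the left of
  \<open>prod_le_weighted_sum_powr\<close> a plain product of cosines; the mean then separates the coordinates, and
  each of them contributes a Wallis integral.
\<close>
theorem haagerup_lower_bound:
  assumes A: "finite A" and p: "\<And>i. i \<in> A \<Longrightarrow> 0 \<le> p i" "(\<Sum>i\<in>A. p i) = 1"
    and zero: "\<And>i. i \<in> A \<Longrightarrow> p i = 0 \<Longrightarrow> a i = 0"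
  shows "(\<Sum>i\<in>A. \<bar>a i\<bar> * (2 / pi * wallis (1 / p i))) \<le> Esigns A (\<lambda>x. \<bar>\<Sum>i\<in>A. a i * x i\<bar>)"
proof -
  \<comment> \<open>Coordinates of weight zero are zero and do not affect the product of cosines.\<close>
  define S where "S = {i \<in> A. 0 < p i}"
  have S: "finite S" "S \<subseteq> A" "\<And>i. i \<in> S \<Longrightarrow> 0 < p i"
    using A by (auto simp: S_def)
  have off: "p i = 0" "a i = 0" if "i \<in> A - S" for i
    using that p zero[of i] by (force simp: S_def)+
  have pS: "(\<Sum>i\<in>S. p i) = 1"
    using p(2) off sum.mono_neutral_left[OF A S(2), of p] by simp
  let ?f = "\<lambda>i t. (1 - \<bar>cos (t * a i)\<bar> powr (1 / p i)) / t\<^sup>2"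
  have f_nonneg: "0 \<le> ?f i t" if "i \<in> S" for i t
    using S(3)[OF that] by (intro divide_nonneg_nonneg) (auto simp: powr_le1)
  have pt: "(\<Sum>i\<in>S. p i * ?f i t) \<le> (1 - (\<Prod>i\<in>A. cos (t * a i))) / t\<^sup>2" for t
  proof -
    have "(\<Prod>i\<in>A. cos (t * a i)) = (\<Prod>i\<in>S. cos (t * a i))"
      using off by (intro prod.mono_neutral_right A S) auto
    also have "\<dots> \<le> (\<Prod>i\<in>S. \<bar>cos (t * a i)\<bar>)"
      by (metis abs_ge_self abs_prod)
    also have "\<dots> \<le> (\<Sum>i\<in>S. p i * \<bar>cos (t * a i)\<bar> powr (1 / p i))"
      using S pS by (intro prod_le_weighted_sum_powr) auto
    finally have "(\<Sum>i\<in>S. p i * (1 - \<bar>cos (t * a i)\<bar> powr (1 / p i))) \<le> 1 - (\<Prod>i\<in>A. cos (t * a i))"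
      using pS by (simp add: right_diff_distrib sum_subtractf)
    then have "(\<Sum>i\<in>S. p i * (1 - \<bar>cos (t * a i)\<bar> powr (1 / p i))) / t\<^sup>2 \<le> (1 - (\<Prod>i\<in>A. cos (t * a i))) / t\<^sup>2"
      by (rule divide_right_mono) simp
    then show ?thesis by (simp add: sum_divide_distrib)
  qed
  have w: "0 \<le> wallis s" for s
    unfolding wallis_def by (cases "(\<lambda>x. cos x powr s) integrable_on {0..pi/2}") (auto intro: Henstock_Kurzweil_Integration.integral_nonneg simp: not_integrable_integral)
  have "ennreal (\<Sum>i\<in>S. \<bar>a i\<bar> * wallis (1 / p i)) = (\<Sum>i\<in>S. ennreal (p i) * ennreal (\<bar>a i\<bar> * (1 / p i * wallis (1 / p i))))"
  proof -
    have "p i * (\<bar>a i\<bar> * (1 / p i * wallis (1 / p i))) = \<bar>a i\<bar> * wallis (1 / p i)" if "i \<in> S" for i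
      using S(3)[OF that] by simp
    then have "(\<Sum>i\<in>S. \<bar>a i\<bar> * wallis (1 / p i)) =
        (\<Sum>i\<in>S. p i * (\<bar>a i\<bar> * (1 / p i * wallis (1 / p i))))"
      by (intro sum.cong) auto
    also have "ennreal \<dots> = (\<Sum>i\<in>S. ennreal (p i) * ennreal (\<bar>a i\<bar> * (1 / p i * wallis (1 / p i))))"
      by (rule sum_ennreal_mult[symmetric]) (use S w in \<open>auto intro!: mult_nonneg_nonneg simp: less_imp_le\<close>)
    finally show ?thesis .
  qed
  also have "\<dots> = (\<Sum>i\<in>S. \<integral>\<^sup>+t. ennreal (p i) * (ennreal (?f i t) * indicator {0<..} t) \<partial>lborel)"
    using S by (intro sum.cong refl) (simp add: nn_integral_cmult nn_integral_one_minus_cos_powr)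
  also have "\<dots> = (\<integral>\<^sup>+t. (\<Sum>i\<in>S. ennreal (p i) * (ennreal (?f i t) * indicator {0<..} t)) \<partial>lborel)"
    by (rule nn_integral_sum[symmetric]) auto
  also have "\<dots> \<le> (\<integral>\<^sup>+t\<in>{0<..}. ennreal ((1 - (\<Prod>i\<in>A. cos (t * a i))) / t\<^sup>2) \<partial>lborel)"
  proof (rule nn_integral_mono)
    fix t :: real
    have "(\<Sum>i\<in>S. ennreal (p i) * ennreal (?f i t)) = ennreal (\<Sum>i\<in>S. p i * ?f i t)"
      using S(3) f_nonneg by (intro sum_ennreal_mult) (auto simp: less_imp_le)
    also have "\<dots> \<le> ennreal ((1 - (\<Prod>i\<in>A. cos (t * a i))) / t\<^sup>2)"
      by (rule ennreal_leI[OF pt])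
    finally show "(\<Sum>i\<in>S. ennreal (p i) * (ennreal (?f i t) * indicator {0<..} t)) \<le>
        ennreal ((1 - (\<Prod>i\<in>A. cos (t * a i))) / t\<^sup>2) * indicator {0<..} t"
      by (simp split: split_indicator)
  qed
  also have "\<dots> = ennreal (pi / 2 * Esigns A (\<lambda>x. \<bar>\<Sum>i\<in>A. a i * x i\<bar>))"
    by (rule nn_integral_char_function[OF A])
  finally have "(\<Sum>i\<in>S. \<bar>a i\<bar> * wallis (1 / p i)) \<le> pi / 2 * Esigns A (\<lambda>x. \<bar>\<Sum>i\<in>A. a i * x i\<bar>)"
    by (subst (asm) ennreal_le_iff) (auto intro!: mult_nonneg_nonneg Esigns_nonneg)
  then have "2 / pi * (\<Sum>i\<in>S. \<bar>a i\<bar> * wallis (1 / p i)) \<le>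
      2 / pi * (pi / 2 * Esigns A (\<lambda>x. \<bar>\<Sum>i\<in>A. a i * x i\<bar>))"
    by (intro mult_left_mono) auto
  moreover have "(\<Sum>i\<in>A. \<bar>a i\<bar> * wallis (1 / p i)) = (\<Sum>i\<in>S. \<bar>a i\<bar> * wallis (1 / p i))"
    using off by (intro sum.mono_neutral_right A S) auto
  moreover have "(\<Sum>i\<in>A. \<bar>a i\<bar> * (2 / pi * wallis (1 / p i))) = 2 / pi * (\<Sum>i\<in>A. \<bar>a i\<bar> * wallis (1 / p i))"
    by (simp add: sum_distrib_left mult_ac)
  ultimately show ?thesis by simp
qed

text \<open>
  The value of the lower bound when all squared coordinates are equal to \<open>1 / s\<close>; it
  increases from \<open>1 / sqrt 2\<close> at \<open>s = 2\<close> to the Gaussian value \<open>sqrt (2 / \<pi>)\<close> at infinity.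
\<close>
definition haagerup_F :: "real \<Rightarrow> real" where
  "haagerup_F s = 2 / pi * (sqrt s * wallis s)"

text \<open>
  The number \<open>m i\<close> is a convenient lower bound for the exponent \<open>1 / p i\<close>; monotonicity replaces
  the latter by the former.
\<close>
corollary haagerup_lower_bound_F:
  assumes A: "finite A" and p: "\<And>i. i \<in> A \<Longrightarrow> 0 \<le> p i" "(\<Sum>i\<in>A. p i) = 1"
    and zero: "\<And>i. i \<in> A \<Longrightarrow> p i = 0 \<Longrightarrow> a i = 0"
    and m: "\<And>i. i \<in> A \<Longrightarrow> 0 < m i" "\<And>i. i \<in> A \<Longrightarrow> m i * p i \<le> 1"
  shows "(\<Sum>i\<in>A. \<bar>a i\<bar> * (sqrt (p i) * haagerup_F (m i))) \<le> Esigns A (\<lambda>x. \<bar>\<Sum>i\<in>A. a i * x i\<bar>)"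
proof -
  have "(\<Sum>i\<in>A. \<bar>a i\<bar> * (sqrt (p i) * haagerup_F (m i))) \<le> (\<Sum>i\<in>A. \<bar>a i\<bar> * (2 / pi * wallis (1 / p i)))"
  proof (rule sum_mono)
    fix i assume i: "i \<in> A"
    show "\<bar>a i\<bar> * (sqrt (p i) * haagerup_F (m i)) \<le> \<bar>a i\<bar> * (2 / pi * wallis (1 / p i))"
    proof (cases "p i = 0")
      case False
      with p i have pi: "0 < p i" by force
      have "m i \<le> 1 / p i" using m(2)[OF i] pi by (simp add: field_simps)
      then have "sqrt (m i) * wallis (m i) \<le> sqrt (1 / p i) * wallis (1 / p i)"
        by (rule sqrt_wallis_mono[OF m(1)[OF i]])
      then have "sqrt (p i) * (sqrt (m i) * wallis (m i)) \<le> wallis (1 / p i)"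
        using pi by (simp add: real_sqrt_divide field_simps)
      then show ?thesis
        by (intro mult_left_mono) (simp_all add: haagerup_F_def field_simps)
    qed (simp add: zero i)
  qed
  also have "\<dots> \<le> Esigns A (\<lambda>x. \<bar>\<Sum>i\<in>A. a i * x i\<bar>)"
    by (rule haagerup_lower_bound[OF A p zero])
  finally show ?thesis .
qed

lemma haagerup_F_2: "haagerup_F 2 = 1 / sqrt 2"
  by (simp add: haagerup_F_def wallis_2 field_simps)

lemma haagerup_F_4: "haagerup_F 4 = 3 / 4"
proof -
  have w: "wallis 4 = 3 / 16 * pi"
    using wallis_plus_2[of 2] by (simp add: wallis_2)
  show ?thesis unfolding haagerup_F_def w by simp
qed

lemma haagerup_F_8: "haagerup_F 8 = 35 / 64 * sqrt 2"
proof -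
  have w: "wallis 8 = 35 / 256 * pi"
    using wallis_plus_2[of 2] wallis_plus_2[of 4] wallis_plus_2[of 6] by (simp add: wallis_2)
  have r: "sqrt 8 = 2 * sqrt 2"
    using real_sqrt_mult[of 4 2] by simp
  show ?thesis unfolding haagerup_F_def w r by simp
qed

text \<open>
  The exact value is \<open>4 / (sqrt 3 * \<pi>)\<close>, so an upper bound for \<open>\<pi>\<close> is needed.  Comparing \<open>wallis 6\<close>,
  a multiple of \<open>\<pi>\<close>, with the rational \<open>wallis 7\<close> provides one.
\<close>
lemma haagerup_F_3: "haagerup_F 3 \<ge> 729 / 1000"
proof -
  have w: "wallis 3 = 2 / 3" "wallis 7 = 16 / 35" "wallis 6 = 5 / 32 * pi"
    using wallis_plus_2[of 1] wallis_plus_2[of 3] wallis_plus_2[of 5]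
      wallis_plus_2[of 2] wallis_plus_2[of 4] by (simp_all add: wallis_1 wallis_2)
  have "sqrt 6 * (5 / 32 * pi) \<le> sqrt 7 * (16 / 35)"
    using sqrt_wallis_mono[of 6 7] by (simp add: w)
  moreover have "2.449 \<le> sqrt 6"
    by (rule real_le_rsqrt) (simp add: power2_eq_square)
  moreover have "sqrt 7 \<le> 2.646"
    by (rule real_le_lsqrt) (simp_all add: power2_eq_square)
  ultimately have "2.449 * (5 / 32 * pi) \<le> 2.646 * (16 / 35)"
    by (smt (verit) mult_right_mono pi_gt_zero divide_pos_pos mult_pos_pos)
  then have "pi \<le> 3.162" by simp
  moreover have "1.732 \<le> sqrt 3"
    by (rule real_le_rsqrt) (simp add: power2_eq_square)
  ultimately have "729 / 1000 * pi \<le> 4 / 3 * sqrt 3"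
    by simp
  then show ?thesis
    using pi_gt_zero unfolding haagerup_F_def w by (simp add: field_simps)
qed

text \<open>
  The weights are the squared coefficients, so that every \<open>\<bar>a k\<bar> * sqrt (p k)\<close> is \<open>(a k)\<^sup>2\<close>.
\<close>
lemma haagerup_two_levels:
  fixes a :: "'i \<Rightarrow> real"
  assumes A: "finite A" and i: "i \<in> A" and unit: "(\<Sum>k\<in>A. (a k)\<^sup>2) = 1"
    and m: "0 < m" "m * (a i)\<^sup>2 \<le> 1"
    and m': "0 < m'" "\<And>k. k \<in> A - {i} \<Longrightarrow> m' * (a k)\<^sup>2 \<le> 1"
  shows "(a i)\<^sup>2 * haagerup_F m + (1 - (a i)\<^sup>2) * haagerup_F m' \<le> Esigns A (\<lambda>x. \<bar>\<Sum>k\<in>A. a k * x k\<bar>)"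
proof -
  let ?m = "\<lambda>k. if k = i then m else m'"
  have "(\<Sum>k\<in>A. \<bar>a k\<bar> * (sqrt ((a k)\<^sup>2) * haagerup_F (?m k))) \<le> Esigns A (\<lambda>x. \<bar>\<Sum>k\<in>A. a k * x k\<bar>)"
    using m m' by (intro haagerup_lower_bound_F A unit) auto
  also have "(\<Sum>k\<in>A. \<bar>a k\<bar> * (sqrt ((a k)\<^sup>2) * haagerup_F (?m k))) = (\<Sum>k\<in>A. (a k)\<^sup>2 * haagerup_F (?m k))"
    by (simp add: power2_eq_square mult.assoc[symmetric])
  also have "\<dots> = (a i)\<^sup>2 * haagerup_F m + (\<Sum>k\<in>A - {i}. (a k)\<^sup>2) * haagerup_F m'"
    using A i by (subst sum.remove[of _ i]) (auto simp: sum_distrib_right)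
  also have "(\<Sum>k\<in>A - {i}. (a k)\<^sup>2) = 1 - (a i)\<^sup>2"
    using A i unit by (simp add: sum_diff1)
  finally show ?thesis .
qed

text \<open>
  For a coefficient above \<open>1 / sqrt 2\<close> its square is too large a weight, because \<open>haagerup_F\<close> is
  smaller than \<open>1 / sqrt 2\<close> at arguments below 2.  It receives the weight \<open>1/2\<close>, and the others share the rest
  in proportion to their squares.
\<close>
lemma haagerup_half_weight:
  fixes a :: "'i \<Rightarrow> real"
  assumes A: "finite A" and i: "i \<in> A" and unit: "(\<Sum>k\<in>A. (a k)\<^sup>2) = 1" and lt: "(a i)\<^sup>2 < 1"
    and m: "0 < m" "\<And>k. k \<in> A - {i} \<Longrightarrow> m * (a k)\<^sup>2 \<le> 2 * (1 - (a i)\<^sup>2)"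
  shows "\<bar>a i\<bar> / 2 + sqrt ((1 - (a i)\<^sup>2) / 2) * haagerup_F m \<le> Esigns A (\<lambda>x. \<bar>\<Sum>k\<in>A. a k * x k\<bar>)"
proof -
  define w where "w = 2 * (1 - (a i)\<^sup>2)"
  have w: "0 < w" using lt by (simp add: w_def)
  let ?p = "\<lambda>k. if k = i then 1 / 2 else (a k)\<^sup>2 / w"
  let ?m = "\<lambda>k. if k = i then 2 else m"
  have rest: "(\<Sum>k\<in>A - {i}. (a k)\<^sup>2) = w / 2"
    using A i unit by (simp add: sum_diff1 w_def)
  have split: "(\<Sum>k\<in>A. if k = i then u else v k) = u + (\<Sum>k\<in>A - {i}. v k)" for u :: real and v
    using A i by (subst sum.remove[of _ i]) auto
  have "(\<Sum>k\<in>A. \<bar>a k\<bar> * (sqrt (?p k) * haagerup_F (?m k))) \<le> Esigns A (\<lambda>x. \<bar>\<Sum>k\<in>A. a k * x k\<bar>)"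
  proof (rule haagerup_lower_bound_F[OF A])
    show "(\<Sum>k\<in>A. ?p k) = 1"
      using w by (simp add: split sum_divide_distrib[symmetric] rest)
    show "?m k * ?p k \<le> 1" if "k \<in> A" for k
      using that m(2)[of k] w by (auto simp: w_def field_simps)
  qed (use w m in \<open>auto split: if_splits\<close>)
  also have "(\<Sum>k\<in>A. \<bar>a k\<bar> * (sqrt (?p k) * haagerup_F (?m k))) =
      (\<Sum>k\<in>A. if k = i then \<bar>a i\<bar> / 2 else (a k)\<^sup>2 / sqrt w * haagerup_F m)"
  proof (intro sum.cong refl)
    fix k
    have "\<bar>a i\<bar> * (sqrt (1 / 2) * haagerup_F 2) = \<bar>a i\<bar> / 2"
      unfolding haagerup_F_2 by (simp add: real_sqrt_divide)
    moreover have "\<bar>a k\<bar> * (sqrt ((a k)\<^sup>2 / w) * haagerup_F m) = (a k)\<^sup>2 / sqrt w * haagerup_F m"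
      by (simp add: real_sqrt_divide power2_eq_square mult.assoc[symmetric])
    ultimately show "\<bar>a k\<bar> * (sqrt (?p k) * haagerup_F (?m k)) =
        (if k = i then \<bar>a i\<bar> / 2 else (a k)\<^sup>2 / sqrt w * haagerup_F m)"
      by simp
  qed
  also have "\<dots> = \<bar>a i\<bar> / 2 + w / 2 / sqrt w * haagerup_F m"
    by (simp add: split sum_distrib_right[symmetric] sum_divide_distrib[symmetric] rest)
  also have "w / 2 / sqrt w = sqrt (w / 4)"
    using w by (simp add: real_sqrt_divide real_div_sqrt)
  also have "w / 4 = (1 - (a i)\<^sup>2) / 2" by (simp add: w_def)
  finally show ?thesis .
qed

section \<open>Numerical comparison with the distance\<close>

text \<open>
  Linearises the square root that hides in the distance; the best \<open>q\<close> is \<open>T\<close> itself, so \<open>q\<close> is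
  always chosen near the largest value of \<open>T\<close> in the region under consideration.
\<close>
lemma le_square_linearised:
  fixes T q :: real
  assumes "0 < q"
  shows "T \<le> (T\<^sup>2 + q\<^sup>2) / (2 * q)"
proof -
  have "0 \<le> (T - q)\<^sup>2" by simp
  then have "T * (2 * q) \<le> T\<^sup>2 + q\<^sup>2" by (simp add: power2_diff)
  then show ?thesis using assms by (simp add: field_simps)
qed

lemma sqrt_2_bounds: "141421 / 100000 \<le> sqrt 2" "sqrt 2 \<le> 141422 / 100000"
  by (rule real_le_rsqrt, simp add: power2_eq_square)
    (rule real_le_lsqrt, simp_all add: power2_eq_square)

text \<open>
  Here \<open>a\<close> and \<open>b\<close> stand for the two largest coordinates, \<open>T\<close> for the upper bound of the distance and
  \<open>K\<close> for the first absolute moment.  Each lemma turns one lower bound for \<open>K\<close> into the desired one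
  in the region where it is strong enough.
\<close>

context
  fixes a b T K :: real
  assumes b0: "0 \<le> b" and ba: "b \<le> a" and T2: "T\<^sup>2 = 2 - sqrt 2 * (a + b)"
begin

lemma distance_le_linear:
  assumes "0 < q" "l \<le> a + b"
  shows "T \<le> (2 - 141421 / 100000 * l + q\<^sup>2) / (2 * q)"
proof -
  have "141421 / 100000 * l \<le> 141421 / 100000 * (a + b)" using assms by simp
  also have "\<dots> \<le> sqrt 2 * (a + b)"
    using sqrt_2_bounds b0 ba by (intro mult_right_mono) auto
  finally have "T\<^sup>2 + q\<^sup>2 \<le> 2 - 141421 / 100000 * l + q\<^sup>2" using T2 by simp
  then have "(T\<^sup>2 + q\<^sup>2) / (2 * q) \<le> (2 - 141421 / 100000 * l + q\<^sup>2) / (2 * q)"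
    using assms by (intro divide_right_mono) auto
  with le_square_linearised[OF assms(1), of T] show ?thesis by linarith
qed

lemma target_from_three_quarters:
  assumes "3 / 4 \<le> K"
  shows "sqrt 2 / 2 + T / 36 \<le> K"
  using distance_le_linear[of "14 / 10" 0] assms b0 ba sqrt_2_bounds by (simp add: power2_eq_square)

lemma target_from_F_3:
  assumes "729 / 1000 \<le> K" "1 / 2 \<le> b"
  shows "sqrt 2 / 2 + T / 36 \<le> K"
  using distance_le_linear[of "77 / 100" 1] assms ba sqrt_2_bounds by (simp add: power2_eq_square)

lemma target_from_F_3_F_4:
  assumes "a\<^sup>2 * (729 / 1000) + (1 - a\<^sup>2) * (3 / 4) \<le> K" "1 / 2 \<le> a" "a\<^sup>2 \<le> 1 / 3"
  shows "sqrt 2 / 2 + T / 36 \<le> K"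
proof -
  have T: "T \<le> 1138 / 1000" using distance_le_linear[of "114 / 100" "1/2"] assms b0 by (simp add: power2_eq_square)
  have "a\<^sup>2 * (729 / 1000) + (1 - a\<^sup>2) * (3 / 4) = 3 / 4 - a\<^sup>2 * (21 / 1000)"
    by (simp add: field_simps)
  then show ?thesis using T assms sqrt_2_bounds by linarith
qed

lemma target_from_F_2_F_8:
  assumes "a\<^sup>2 * (1 / sqrt 2) + (1 - a\<^sup>2) * (35 / 64 * sqrt 2) \<le> K" "1 / 3 \<le> a\<^sup>2" "a\<^sup>2 \<le> 1 / 2"
  shows "sqrt 2 / 2 + T / 36 \<le> K"
proof -
  have "(577 / 1000)\<^sup>2 \<le> a\<^sup>2" using assms by (simp add: power2_eq_square)
  then have "577 / 1000 \<le> a" using b0 ba by (rule power2_le_imp_le[OF _ order_trans])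
  then have T: "T \<le> 109 / 100" using distance_le_linear[of "11 / 10" "577 / 1000"] b0 by (simp add: power2_eq_square)
  have "141421 / 100000 * (67 / 128) \<le> sqrt 2 * (35 / 64 - a\<^sup>2 * (3 / 64))"
    using assms sqrt_2_bounds by (intro mult_mono) auto
  also have "\<dots> = a\<^sup>2 * (sqrt 2 / 2) + (1 - a\<^sup>2) * (35 / 64 * sqrt 2)"
    by (simp add: field_simps)
  also have "sqrt 2 / 2 = 1 / sqrt 2" by (simp add: field_simps)
  finally show ?thesis using T assms(1) sqrt_2_bounds by linarith
qed

text \<open>
  Both sides are close to each other along the whole range of \<open>a\<close>, so the distance is
  bounded by a linear function of \<open>a\<close> instead of a constant, and \<open>a\<^sup>2\<close> by its chord.
\<close>
lemma target_from_F_2_F_4: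
  assumes "a\<^sup>2 * (1 / sqrt 2) + (1 - a\<^sup>2) * (3 / 4) \<le> K" "1 / 3 \<le> a\<^sup>2" "a\<^sup>2 \<le> 1 / 2" "1 / 8 \<le> b\<^sup>2"
  shows "sqrt 2 / 2 + T / 36 \<le> K"
proof -
  have "(577 / 1000)\<^sup>2 \<le> a\<^sup>2" using assms by (simp add: power2_eq_square)
  then have al: "577 / 1000 \<le> a" using b0 ba by (rule power2_le_imp_le[OF _ order_trans])
  have "a\<^sup>2 \<le> (7072 / 10000)\<^sup>2" using assms by (simp add: power2_eq_square)
  then have au: "a \<le> 7072 / 10000" by (rule power2_le_imp_le) simp
  have "(3535 / 10000)\<^sup>2 \<le> b\<^sup>2" using assms by (simp add: power2_eq_square)
  then have bl: "3535 / 10000 \<le> b" using b0 by (rule power2_le_imp_le)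
  have T: "T \<le> (2 - 141421 / 100000 * (a + 3535 / 10000) + (77 / 100)\<^sup>2) / (2 * (77 / 100))"
    using distance_le_linear[of "77 / 100" "a + 3535 / 10000"] bl by simp
  have "0 \<le> (a - 577 / 1000) * (7072 / 10000 - a)" using al au by simp
  then have conc: "a\<^sup>2 \<le> 12842 / 10000 * a - 4080544 / 10000000" by (simp add: power2_eq_square algebra_simps)
  have "1 / sqrt 2 = sqrt 2 / 2" by (simp add: real_div_sqrt)
  then have "a\<^sup>2 * (7071 / 10000) \<le> a\<^sup>2 * (1 / sqrt 2)"
    using sqrt_2_bounds by (intro mult_left_mono) auto
  then have "a\<^sup>2 * (7071 / 10000) + (1 - a\<^sup>2) * (3 / 4) \<le> K" using assms(1) by linarith
  then have "3 / 4 - 429 / 10000 * a\<^sup>2 \<le> K" by (simp add: field_simps)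
  moreover have "(2 - 141421 / 100000 * (a + 3535 / 10000) + (77 / 100)\<^sup>2) / (2 * (77 / 100)) \<le> 13592 / 10000 - 9183 / 10000 * a"
    using b0 ba by (simp add: power2_eq_square field_simps)
  ultimately show ?thesis using T conc sqrt_2_bounds au by linarith
qed

text \<open>
  The graph of \<open>a / 2 + 35 / 64 * sqrt (1 - a\<^sup>2)\<close> stays above \<open>735 / 1000\<close> on this range; isolating
  and squaring the root leaves a quadratic inequality, which the chord of \<open>a\<^sup>2\<close> settles.
\<close>
lemma target_from_half_weight:
  assumes "a / 2 + sqrt ((1 - a\<^sup>2) / 2) * (35 / 64 * sqrt 2) \<le> K" "1 / 2 \<le> a\<^sup>2" "a \<le> 735 / 1000"
  shows "sqrt 2 / 2 + T / 36 \<le> K"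
proof -
  have "(707 / 1000)\<^sup>2 \<le> a\<^sup>2" using assms by (simp add: power2_eq_square)
  then have al: "707 / 1000 \<le> a" using b0 ba by (rule power2_le_imp_le[OF _ order_trans])
  have T: "T \<le> 1001 / 1000" using distance_le_linear[of 1 "707 / 1000"] al b0 by simp
  have "((735 / 1000 - a / 2) * (64 / 35))\<^sup>2 \<le> 1 - a\<^sup>2"
  proof -
    have "0 \<le> (a - 707 / 1000) * (735 / 1000 - a)" using al assms by simp
    then have "a\<^sup>2 \<le> 1442 / 1000 * a - 519645 / 1000000" by (simp add: power2_eq_square field_simps)
    moreover have "((735 / 1000 - a / 2) * (64 / 35))\<^sup>2 = 1806336 / 1000000 - 24576 / 10000 * a + 1024 / 1225 * a\<^sup>2"
      by (simp add: power2_eq_square field_simps)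
    ultimately show ?thesis using assms(3) by linarith
  qed
  then have "(735 / 1000 - a / 2) * (64 / 35) \<le> sqrt (1 - a\<^sup>2)"
    by (rule real_le_rsqrt)
  then have "735 / 1000 \<le> a / 2 + 35 / 64 * sqrt (1 - a\<^sup>2)"
    by (simp add: field_simps)
  moreover have "a / 2 + 35 / 64 * sqrt (1 - a\<^sup>2) \<le> K"
    using assms(1) by (simp add: real_sqrt_divide)
  ultimately show ?thesis using T sqrt_2_bounds by linarith
qed

lemma target_from_largest_coefficient:
  assumes "a \<le> K" "735 / 1000 \<le> a"
  shows "sqrt 2 / 2 + T / 36 \<le> K"
  using distance_le_linear[of "98 / 100" "735 / 1000"] assms b0 sqrt_2_bounds by (simp add: power2_eq_square)

text \<open>
  As \<open>a\<^sup>2 \<ge> 1/2\<close>, the difference \<open>a\<^sup>2 - b\<^sup>2 - c\<^sup>2 = 2 * a\<^sup>2 - 1\<close> can be dropped, and the product of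
  \<open>b\<close> and \<open>c\<close> is bounded away from zero.
\<close>
lemma target_from_deficit:
  assumes K: "1 + (a\<^sup>2 - b\<^sup>2 + sqrt 2 * b * c - c\<^sup>2) / 2 \<le> 2 * K\<^sup>2" "0 \<le> K"
    and c: "0 \<le> c" "c\<^sup>2 = 1 - a\<^sup>2 - b\<^sup>2"
    and ab: "1 / 2 \<le> a\<^sup>2" "a \<le> 735 / 1000" "1 / 3 \<le> b" "b \<le> 1 / 2"
  shows "sqrt 2 / 2 + T / 36 \<le> K"
proof -
  have "(707 / 1000)\<^sup>2 \<le> a\<^sup>2" using ab by (simp add: power2_eq_square)
  then have al: "707 / 1000 \<le> a" using b0 ba by (rule power2_le_imp_le[OF _ order_trans])
  have T: "T \<le> 73 / 100" using distance_le_linear[of "727 / 1000" "707 / 1000 + 1/3"] al ab by (simp add: power2_eq_square)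
  have "a\<^sup>2 \<le> (735 / 1000)\<^sup>2" "b\<^sup>2 \<le> (1/2)\<^sup>2"
    using ab ba b0 by (auto intro!: power_mono)
  then have "(45 / 100)\<^sup>2 \<le> c\<^sup>2" unfolding c(2) by (simp add: power2_eq_square)
  then have cl: "45 / 100 \<le> c" using c(1) by (rule power2_le_imp_le)
  have "141421 / 100000 * (1/3) * (45 / 100) \<le> sqrt 2 * b * c"
    using cl ab b0 sqrt_2_bounds by (intro mult_mono) auto
  then have X: "212 / 1000 \<le> sqrt 2 * b * c" by simp
  have "106 / 100 \<le> M" if "1 + (A - B + X - C) / 2 \<le> M" "C = 1 - A - B" "1 / 2 \<le> A" "212 / 1000 \<le> X"
    for A B C X M :: real
    using that by (simp add: field_simps)
  from this[OF K(1) c(2) ab(1) X] have "106 / 100 \<le> 2 * K\<^sup>2" .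
  then have "(728 / 1000)\<^sup>2 \<le> K\<^sup>2" by (simp add: power2_eq_square)
  then have "728 / 1000 \<le> K" using K(2) by (rule power2_le_imp_le)
  then show ?thesis using T sqrt_2_bounds by simp
qed

text \<open>
  The region that contains the extremiser.  In the rotated coordinates \<open>\<sigma> = (a + b) / sqrt 2\<close> and
  \<open>\<delta> = (a - b) / sqrt 2\<close> it is the point \<open>\<sigma> = 1\<close>, \<open>\<delta> = c = 0\<close>, and both the distance and the
  deficit are comparable to \<open>c + \<delta>\<close>.  The first hypothesis controls \<open>\<delta>\<close>, the second one \<open>c\<close>; their mean
  controls the sum.
\<close>
lemma target_from_deficits:
  assumes K: "1 + (a\<^sup>2 - b\<^sup>2 + sqrt 2 * b * c - c\<^sup>2) / 2 \<le> 2 * K\<^sup>2"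
      "1 + c * (sqrt 2 * (a + b) / 2 - c) \<le> 2 * K\<^sup>2" "0 \<le> K"
    and c: "0 \<le> c" "c\<^sup>2 = 1 - a\<^sup>2 - b\<^sup>2"
    and ab: "1 / 3 \<le> a\<^sup>2" "1 / 2 \<le> b" and T0: "0 \<le> T"
  shows "sqrt 2 / 2 + T / 36 \<le> K"
proof -
  define \<sigma> \<delta> where "\<sigma> = sqrt 2 * (a + b) / 2" and "\<delta> = sqrt 2 * (a - b) / 2"
  have r: "sqrt 2 * sqrt 2 = 2" by simp
  have "(5773 / 10000)\<^sup>2 \<le> a\<^sup>2" using ab by (simp add: power2_eq_square)
  then have al: "5773 / 10000 \<le> a" using b0 ba by (rule power2_le_imp_le[OF _ order_trans])
  have \<delta>0: "0 \<le> \<delta>" using ba by (simp add: \<delta>_def)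
  have "141421 / 100000 * (5773 / 10000 + 5 / 10) \<le> sqrt 2 * (a + b)"
    using al ab sqrt_2_bounds by (intro mult_mono) auto
  then have \<sigma>l: "7617 / 10000 \<le> \<sigma>" by (simp add: \<sigma>_def)
  have s2: "\<sigma>\<^sup>2 + \<delta>\<^sup>2 = a\<^sup>2 + b\<^sup>2" "a\<^sup>2 - b\<^sup>2 = 2 * \<sigma> * \<delta>" "sqrt 2 * b = \<sigma> - \<delta>"
    unfolding \<sigma>_def \<delta>_def using r by (simp_all add: power2_eq_square field_simps)
  have T2': "T\<^sup>2 = 2 - 2 * \<sigma>" using T2 by (simp add: \<sigma>_def)
  have "(1/2)\<^sup>2 \<le> b\<^sup>2" using ab by (intro power_mono) auto
  then have "c\<^sup>2 \<le> (6456 / 10000)\<^sup>2" unfolding c(2) using ab by (simp add: power2_eq_square)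
  then have cu: "c \<le> 6456 / 10000" by (rule power2_le_imp_le) simp
  have cd: "c\<^sup>2 + \<delta>\<^sup>2 = (1 - \<sigma>) * (1 + \<sigma>)"
    using s2(1) c(2) by (simp add: power2_eq_square algebra_simps)
  have \<sigma>1: "\<sigma> \<le> 1"
  proof (rule ccontr)
    assume "\<not> \<sigma> \<le> 1"
    then have "(1 - \<sigma>) * (1 + \<sigma>) < 0" using \<sigma>l by (intro mult_neg_pos) auto
    moreover have "0 \<le> c\<^sup>2 + \<delta>\<^sup>2" by simp
    ultimately show False using cd by linarith
  qed
  have Tcd: "T \<le> 10656 / 10000 * (c + \<delta>)"
  proof (rule power2_le_imp_le)
    have "(1 - \<sigma>) * (17617 / 10000) \<le> (1 - \<sigma>) * (1 + \<sigma>)"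
      using \<sigma>1 \<sigma>l by (intro mult_left_mono) auto
    then have "T\<^sup>2 \<le> 2 / (17617 / 10000) * (c\<^sup>2 + \<delta>\<^sup>2)" unfolding T2' cd by simp
    also have "\<dots> \<le> (10656 / 10000)\<^sup>2 * (c\<^sup>2 + \<delta>\<^sup>2)" by (intro mult_right_mono) (auto simp: power2_eq_square)
    also have "\<dots> \<le> (10656 / 10000)\<^sup>2 * (c + \<delta>)\<^sup>2"
      using c(1) \<delta>0 by (intro mult_left_mono) (auto simp: power2_sum)
    finally show "T\<^sup>2 \<le> (10656 / 10000 * (c + \<delta>))\<^sup>2" by (simp only: power_mult_distrib)
  qed (use c \<delta>0 in auto)
  have Tu: "T \<le> 6905 / 10000"
    by (rule power2_le_imp_le) (use T2' \<sigma>l in \<open>auto simp: power2_eq_square\<close>)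
  \<comment> \<open>The constant bounds \<open>sqrt 2 / 18 + T / 648\<close>, using the bound for \<open>T\<close> just shown.\<close>
  have "2 * (sqrt 2 / 2 + T / 36)\<^sup>2 = 1 + T * (sqrt 2 / 18 + T / 648)"
    using r by (simp add: power2_eq_square field_simps)
  also have "\<dots> \<le> 1 + 10656 / 10000 * (c + \<delta>) * (7964 / 100000)"
    using Tcd T0 Tu sqrt_2_bounds c(1) \<delta>0 by (intro add_left_mono mult_mono) auto
  also have "\<dots> \<le> 1 + (\<delta> * (\<sigma> / 2 - c / 4) + 3 / 4 * (c * (\<sigma> - c)))"
  proof -
    have "\<delta> * (2 / 10) \<le> \<delta> * (\<sigma> / 2 - c / 4)" using \<delta>0 \<sigma>l cu by (intro mult_left_mono) auto
    moreover have "c * (116 / 1000) \<le> c * (\<sigma> - c)" using c(1) \<sigma>l cu by (intro mult_left_mono) auto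
    moreover have "10656 / 10000 * (c + \<delta>) * (7964 / 100000) \<le> \<delta> * (2 / 10) + 3 / 4 * (c * (116 / 1000))"
      using c(1) \<delta>0 by simp
    ultimately show ?thesis by linarith
  qed
  also have "\<dots> \<le> 2 * K\<^sup>2"
  proof -
    have "1 + (2 * \<sigma> * \<delta> + (\<sigma> - \<delta>) * c - c\<^sup>2) / 2 \<le> 2 * K\<^sup>2"
      using K(1) unfolding s2(2,3) .
    moreover have "1 + (X / 2 + Y) / 2 \<le> M" if "1 + X / 2 \<le> M" "1 + Y \<le> M" for X Y M :: real
      using that by (simp add: field_simps)
    moreover have "1 + c * (\<sigma> - c) \<le> 2 * K\<^sup>2" using K(2) by (simp add: \<sigma>_def)
    moreover have "\<delta> * (\<sigma> / 2 - c / 4) + 3 / 4 * (c * (\<sigma> - c)) =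
       ((2 * \<sigma> * \<delta> + (\<sigma> - \<delta>) * c - c\<^sup>2) / 2 + c * (\<sigma> - c)) / 2"
      by (simp add: power2_eq_square field_simps)
    ultimately show ?thesis by presburger
  qed
  finally have "(sqrt 2 / 2 + T / 36)\<^sup>2 \<le> K\<^sup>2" by simp
  then show ?thesis using K(3) by (rule power2_le_imp_le)
qed

end

section \<open>The stability estimate\<close>

text \<open>
  The product of uniform laws is the uniform law on the product set.
\<close>
lemma khinchine_K_eq_Esigns:
  fixes \<omega> :: "real ^ 'n"
  shows "khinchine_K \<omega> = Esigns UNIV (\<lambda>x. \<bar>\<Sum>i\<in>UNIV. \<omega> $ i * x i\<bar>)"
proof -
  have "Pi_pmf (UNIV :: 'n set) 0 (\<lambda>_. rademacher_pmf) = pmf_of_set (signs UNIV)"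
    unfolding rademacher_pmf_def signs_def by (rule Pi_pmf_of_set) auto
  moreover have "signs (UNIV :: 'n set) \<noteq> {}"
    using card_signs[of "UNIV :: 'n set"] by (intro notI) simp
  ultimately show ?thesis
    by (simp add: khinchine_K_def Esigns_def integral_pmf_of_set finite_signs card_signs)
qed

text \<open>
  The competitor moves the coordinates \<open>i\<close> and \<open>j\<close> towards zero by \<open>1 / sqrt 2\<close>.
\<close>
lemma tau_le_pair:
  fixes \<omega> :: "real ^ 'n"
  assumes ij: "i \<noteq> j" and n: "norm \<omega> = 1"
  shows "tau \<omega> \<le> sqrt (2 - sqrt 2 * (\<bar>\<omega> $ i\<bar> + \<bar>\<omega> $ j\<bar>))"
proof -
  define s t :: real where "s = (if 0 \<le> \<omega> $ i then -1 else 1)" and "t = (if 0 \<le> \<omega> $ j then -1 else 1)"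
  have st: "s * \<omega> $ i = - \<bar>\<omega> $ i\<bar>" "t * \<omega> $ j = - \<bar>\<omega> $ j\<bar>" "s\<^sup>2 = 1" "t\<^sup>2 = 1"
    by (auto simp: s_def t_def)
  let ?v = "\<lambda>(i, j, s, t). \<omega> + (s / sqrt 2) *\<^sub>R axis i 1 + (t / sqrt 2) *\<^sub>R axis j 1"
  let ?S = "{norm (\<omega> + (s / sqrt 2) *\<^sub>R axis i 1 + (t / sqrt 2) *\<^sub>R axis j 1) | i j s t.
            i \<noteq> j \<and> s \<in> {-1, 1} \<and> t \<in> {-1, 1}}"
  have "finite ((\<lambda>q. norm (?v q)) ` (UNIV \<times> UNIV \<times> {-1, 1} \<times> {-1, 1}))"
    by simp
  moreover have "?S \<subseteq> (\<lambda>q. norm (?v q)) ` (UNIV \<times> UNIV \<times> {-1, 1} \<times> {-1, 1})"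
    by (force simp: image_iff)
  ultimately have "finite ?S"
    by (rule rev_finite_subset)
  moreover have "norm (?v (i, j, s, t)) \<in> ?S"
  proof -
    have "s \<in> {-1, 1}" "t \<in> {-1, 1}" by (auto simp: s_def t_def)
    then show ?thesis using ij unfolding case_prod_conv by blast
  qed
  ultimately have "tau \<omega> \<le> norm (?v (i, j, s, t))"
    unfolding tau_def by (rule Min_le)
  also have "\<dots> = sqrt (2 - sqrt 2 * (\<bar>\<omega> $ i\<bar> + \<bar>\<omega> $ j\<bar>))"
  proof -
    have "\<omega> \<bullet> \<omega> = 1" using n by (simp add: dot_square_norm)
    moreover have "axis i 1 \<bullet> (axis j 1 :: real ^ 'n) = 0" "axis j 1 \<bullet> (axis i 1 :: real ^ 'n) = 0"
      using ij by (auto simp: inner_axis_axis)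
    moreover have "axis k 1 \<bullet> (axis k 1 :: real ^ 'n) = 1" for k
      by (simp add: inner_axis_axis)
    moreover have "\<omega> \<bullet> axis k 1 = \<omega> $ k" "axis k 1 \<bullet> \<omega> = \<omega> $ k" for k
      by (simp_all add: inner_axis inner_axis')
    ultimately have "?v (i, j, s, t) \<bullet> ?v (i, j, s, t) =
        1 + s\<^sup>2 / 2 + t\<^sup>2 / 2 + 2 / sqrt 2 * (s * \<omega> $ i) + 2 / sqrt 2 * (t * \<omega> $ j)"
      by (simp add: inner_add_left inner_add_right power2_eq_square algebra_simps)
    also have "\<dots> = 2 - sqrt 2 * (\<bar>\<omega> $ i\<bar> + \<bar>\<omega> $ j\<bar>)"
      by (simp only: st real_div_sqrt) (simp add: algebra_simps)
    finally show ?thesis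
      by (simp only: norm_eq_sqrt_inner)
  qed
  finally show ?thesis .
qed

theorem theorem3:
  fixes \<omega> :: "real ^ 'n"
  assumes "CARD('n) \<ge> 2"
    and "norm \<omega> = 1"
  shows "khinchine_K \<omega> \<ge> 1 / sqrt 2 + 1 / 36 * tau \<omega>"
proof -
  define w where "w = (\<lambda>k. \<omega> $ k)"
  define K where "K = Esigns UNIV (\<lambda>x. \<bar>\<Sum>k\<in>UNIV. w k * x k\<bar>)"
  have fin: "finite (UNIV :: 'n set)" by simp
  have unit: "(\<Sum>k\<in>UNIV. (w k)\<^sup>2) = 1"
    using assms(2) unfolding norm_vec_def L2_set_def w_def by simp
  \<comment> \<open>The indices of a largest and of a second largest coordinate.\<close>
  obtain i where i: "\<And>k. \<bar>w k\<bar> \<le> \<bar>w i\<bar>"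
  proof -
    have "Max (range (\<lambda>k. \<bar>w k\<bar>)) \<in> range (\<lambda>k. \<bar>w k\<bar>)" by (rule Max_in) auto
    then obtain i where "Max (range (\<lambda>k. \<bar>w k\<bar>)) = \<bar>w i\<bar>" by blast
    then show thesis using that[of i] by (metis Max_ge finite finite_imageI rangeI)
  qed
  obtain j where ij: "i \<noteq> j" and j: "\<And>k. k \<noteq> i \<Longrightarrow> \<bar>w k\<bar> \<le> \<bar>w j\<bar>"
  proof -
    let ?R = "(\<lambda>k. \<bar>w k\<bar>) ` (UNIV - {i})"
    have "UNIV - {i} \<noteq> {}"
    proof
      assume "UNIV - {i} = {}"
      then have "UNIV = {i}" by auto
      then have "CARD('n) = card {i}" by (rule arg_cong)
      then show False using assms(1) by simp
    qed
    then have "Max ?R \<in> ?R" by (intro Max_in) auto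
    then obtain j where "j \<noteq> i" "Max ?R = \<bar>w j\<bar>" by blast
    moreover have "\<bar>w k\<bar> \<le> Max ?R" if "k \<noteq> i" for k
      using that by (intro Max_ge) auto
    ultimately show thesis by (intro that[of j]) auto
  qed
  define a b where "a = \<bar>w i\<bar>" and "b = \<bar>w j\<bar>"
  have b0: "0 \<le> b" and ba: "b \<le> a" and a2: "(w i)\<^sup>2 = a\<^sup>2" and b2: "(w j)\<^sup>2 = b\<^sup>2"
    using i by (simp_all add: a_def b_def)
  define T where "T = sqrt (2 - sqrt 2 * (a + b))"
  have tau: "tau \<omega> \<le> T"
    using tau_le_pair[OF ij assms(2)] by (simp add: T_def a_def b_def w_def)
  have pair: "a\<^sup>2 + b\<^sup>2 \<le> 1"
  proof -
    have "(\<Sum>k\<in>{i, j}. (w k)\<^sup>2) \<le> (\<Sum>k\<in>UNIV. (w k)\<^sup>2)"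
      by (rule sum_mono2) auto
    then show ?thesis using ij unit by (simp add: a2 b2)
  qed
  have "0 \<le> 2 - sqrt 2 * (a + b)"
  proof -
    have "(a + b)\<^sup>2 \<le> 2 * (a\<^sup>2 + b\<^sup>2)"
      using zero_le_power2[of "a - b"] by (simp add: power2_eq_square algebra_simps)
    then have "(a + b)\<^sup>2 \<le> (sqrt 2)\<^sup>2" using pair by simp
    then have "a + b \<le> sqrt 2" by (rule power2_le_imp_le) simp
    then have "sqrt 2 * (a + b) \<le> sqrt 2 * sqrt 2" by (rule mult_left_mono) simp
    then show ?thesis by simp
  qed
  then have T0: "0 \<le> T" and T2: "T\<^sup>2 = 2 - sqrt 2 * (a + b)"
    by (simp_all add: T_def)
  define c where "c = sqrt (1 - a\<^sup>2 - b\<^sup>2)"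
  have c: "0 \<le> c" "c\<^sup>2 = 1 - a\<^sup>2 - b\<^sup>2"
    using pair by (simp_all add: c_def)
  have D1: "1 + (a\<^sup>2 - b\<^sup>2 + sqrt 2 * b * c - c\<^sup>2) / 2 \<le> 2 * K\<^sup>2"
    and D2: "1 + c * (sqrt 2 * (a + b) / 2 - c) \<le> 2 * K\<^sup>2"
    using khinchine_two_coefficients[OF fin UNIV_I UNIV_I ij unit]
    by (simp_all only: a2 b2 a_def[symmetric] b_def[symmetric] c_def[symmetric] K_def)
  have aK: "a \<le> K"
    unfolding a_def K_def by (rule abs_coeff_le_Esigns) auto
  then have K0: "0 \<le> K" using b0 ba by linarith
  \<comment> \<open>Every coordinate other than the largest one is at most \<open>b\<close>.\<close>
  have H: "a\<^sup>2 * haagerup_F m + (1 - a\<^sup>2) * haagerup_F m' \<le> K"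
    if m: "0 < m" "m * a\<^sup>2 \<le> 1" "0 < m'" "m' * b\<^sup>2 \<le> 1" for m m'
    unfolding K_def a2[symmetric]
  proof (rule haagerup_two_levels[OF fin UNIV_I unit])
    fix k assume "k \<in> UNIV - {i}"
    then have "(w k)\<^sup>2 \<le> b\<^sup>2"
      using j[of k] power_mono[of "\<bar>w k\<bar>" b 2] by (simp add: b_def)
    then have "m' * (w k)\<^sup>2 \<le> m' * b\<^sup>2" using m(3) by (intro mult_left_mono) auto
    then show "m' * (w k)\<^sup>2 \<le> 1" using m(4) by linarith
  qed (use m a2 in auto)
  have b2_le: "b\<^sup>2 \<le> a\<^sup>2" using b0 ba by (intro power_mono) auto
  note cs = b0 ba T2
  have target: "sqrt 2 / 2 + T / 36 \<le> K"
  \<comment> \<open>Haagerup's bound covers small \<open>a\<close> and small \<open>b\<close>, the deficit covers large \<open>b\<close>; for \<open>b \<le> 1/2\<close> and \<open>a > 735 / 1000\<close> already \<open>K \<ge> a\<close> suffices.\<close>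
  proof (cases "a \<le> 1 / 2")
    case True
    then have "a\<^sup>2 \<le> (1 / 2)\<^sup>2" using b0 ba by (intro power_mono) auto
    then have "a\<^sup>2 \<le> 1 / 4" by (simp add: power2_eq_square)
    with H[of 4 4] b2_le have "3 / 4 \<le> K" by (simp add: haagerup_F_4 field_simps)
    then show ?thesis by (rule target_from_three_quarters[OF cs])
  next
    case a_half: False
    show ?thesis
    proof (cases "a\<^sup>2 \<le> 1 / 3")
      case a_third: True
      show ?thesis
      proof (cases "b \<le> 1 / 2")
        case True
        then have "b\<^sup>2 \<le> (1 / 2)\<^sup>2" using b0 by (intro power_mono) auto
        then have "a\<^sup>2 * haagerup_F 3 + (1 - a\<^sup>2) * (3 / 4) \<le> K"
          using H[of 3 4] a_third by (simp add: haagerup_F_4 power2_eq_square)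
        moreover have "a\<^sup>2 * (729 / 1000) \<le> a\<^sup>2 * haagerup_F 3"
          by (intro mult_left_mono haagerup_F_3) simp
        ultimately have "a\<^sup>2 * (729 / 1000) + (1 - a\<^sup>2) * (3 / 4) \<le> K" by linarith
        then show ?thesis using a_half a_third by (intro target_from_F_3_F_4[OF cs]) auto
      next
        case False
        have "haagerup_F 3 \<le> K" using H[of 3 3] a_third b2_le by (simp add: algebra_simps)
        then show ?thesis using False haagerup_F_3 by (intro target_from_F_3[OF cs]) auto
      qed
    next
      case a_third: False
      show ?thesis
      proof (cases "b \<le> 1 / 2")
        case False
        then show ?thesis using a_third by (intro target_from_deficits[OF cs D1 D2 K0 c _ _ T0]) auto
      next
        case b_half: True
        then have b4: "b\<^sup>2 \<le> 1 / 4" using b0 power_mono[of b "1/2" 2] by (simp add: power2_eq_square)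
        show ?thesis
        proof (cases "a\<^sup>2 \<le> 1 / 2")
          case a2_small: True
          show ?thesis
          proof (cases "b\<^sup>2 \<le> 1 / 8")
            case True
            then have "a\<^sup>2 * (1 / sqrt 2) + (1 - a\<^sup>2) * (35 / 64 * sqrt 2) \<le> K"
              using H[of 2 8] a2_small unfolding haagerup_F_2 haagerup_F_8 by simp
            then show ?thesis using a_third a2_small by (intro target_from_F_2_F_8[OF cs]) auto
          next
            case False
            have "a\<^sup>2 * (1 / sqrt 2) + (1 - a\<^sup>2) * (3 / 4) \<le> K"
              using H[of 2 4] a2_small b4 unfolding haagerup_F_2 haagerup_F_4 by simp
            then show ?thesis using a_third a2_small False by (intro target_from_F_2_F_4[OF cs]) auto
          qed
        next
          case a2_big: False
          show ?thesis
          proof (cases "a \<le> 735 / 1000")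
            case False
            then show ?thesis using aK by (intro target_from_largest_coefficient[OF cs]) auto
          next
            case a_small: True
            show ?thesis
            proof (cases "b \<le> 1 / 3")
              case False
              then show ?thesis
                using a2_big a_small b_half by (intro target_from_deficit[OF cs D1 K0 c]) auto
            next
              case True
              have a2_lt: "a\<^sup>2 \<le> (735 / 1000)\<^sup>2"
                using a_small b0 ba by (intro power_mono) auto
              have b9: "b\<^sup>2 \<le> (1 / 3)\<^sup>2"
                using True b0 by (intro power_mono) auto
              have "\<bar>w i\<bar> / 2 + sqrt ((1 - (w i)\<^sup>2) / 2) * haagerup_F 8 \<le> Esigns UNIV (\<lambda>x. \<bar>\<Sum>k\<in>UNIV. w k * x k\<bar>)"
              proof (rule haagerup_half_weight[OF fin UNIV_I unit])
                show "(w i)\<^sup>2 < 1" unfolding a2 using a2_lt by (simp add: power2_eq_square)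
                fix k assume "k \<in> UNIV - {i}"
                then have "(w k)\<^sup>2 \<le> b\<^sup>2"
                  using j[of k] power_mono[of "\<bar>w k\<bar>" b 2] by (simp add: b_def)
                then show "8 * (w k)\<^sup>2 \<le> 2 * (1 - (w i)\<^sup>2)"
                  unfolding a2 using a2_lt b9 by (simp add: power_divide)
              qed simp
              then have "a / 2 + sqrt ((1 - a\<^sup>2) / 2) * haagerup_F 8 \<le> K"
                by (simp only: a2 a_def[symmetric] K_def)
              then show ?thesis
                unfolding haagerup_F_8 using a2_big a_small by (intro target_from_half_weight[OF cs]) auto
            qed
          qed
        qed
      qed
    qed
  qed
  have "1 / sqrt 2 + 1 / 36 * tau \<omega> \<le> sqrt 2 / 2 + T / 36"
  proof -
    have "1 / sqrt 2 = sqrt 2 / 2" by (simp add: field_simps)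
    then show ?thesis using tau by linarith
  qed
  also have "\<dots> \<le> K" by (rule target)
  also have "K = khinchine_K \<omega>"
    unfolding K_def w_def by (rule khinchine_K_eq_Esigns[symmetric])
  finally show ?thesis .
qed

end
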